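(* Let $K$ be an algebraically closed field, let $R=K[x_1,\ldots,x_N]$ be a polynomial ring, let $k\ge 1$ be an integer, and let $F\in R$ be a form of degree $3$. (1) If $\operatorname{char}K=2$ and $F$ is $2(k-1)(2k+1)$-strong, then the ideal of $R$ generated by $F$ and all of its partial derivatives has height at least $k$. (2) If $\operatorname{char}K=3$ and $F$ is $(2k^2-k)$-strong, then the ideal of $R$ generated by $F$ and all of its partial derivatives has height at least $k$.
   Context: A form (homogeneous polynomial) $F$ has a $k$-collapse if $F=\sum_{i=1}^{k}G_iH_i$, where each $G_i$ is a form of positive degree strictly less than $\deg F$ (or is $0$) and each $H_i$ is a form of degree $\deg F-\deg G_i$ (or is $0$); only $0$ has a $0$-collapse. $F$ is $k$-strong if it has no $k$-collapse. *)

theory Defs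
  imports
    "HOL-Library.Poly_Mapping"
    "HOL-Library.Extended_Nat"
    "HOL-Computational_Algebra.Computational_Algebra"
    "HOL-Algebra.Ideal"
    "HOL-Algebra.Algebraic_Closure_Type"
begin

text \<open>
  Polynomials over \<open>'k\<close> in the \<open>CARD('n)\<close> variables indexed by the finite type \<open>'n\<close>: finitely
  supported maps from exponent vectors to coefficients, with the convolution product that
  \<^theory>\<open>HOL-Library.Poly_Mapping\<close> provides.
\<close>

type_synonym ('n, 'k) mpoly = "('n \<Rightarrow>\<^sub>0 nat) \<Rightarrow>\<^sub>0 'k"

definition mon_degree :: "('n::finite \<Rightarrow>\<^sub>0 nat) \<Rightarrow> nat" where
  "mon_degree m = (\<Sum>i\<in>UNIV. Poly_Mapping.lookup m i)"

text \<open>The degree of the zero polynomial is set to 0.\<close>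

definition total_degree :: "('n::finite, 'k::zero) mpoly \<Rightarrow> nat" where
  "total_degree F = (if F = 0 then 0 else Max (mon_degree ` Poly_Mapping.keys F))"

text \<open>The zero polynomial counts as a form of every degree.\<close>

definition is_form :: "nat \<Rightarrow> ('n::finite, 'k::zero) mpoly \<Rightarrow> bool" where
  "is_form d F \<longleftrightarrow> (\<forall>m\<in>Poly_Mapping.keys F. mon_degree m = d)"

text \<open>
  Formal partial derivative. When the exponent of the \<open>i\<close>-th variable in \<open>m\<close> is 0, the truncated
  subtraction is harmless because the coefficient vanishes.
\<close>

definition partial_deriv :: "'n \<Rightarrow> ('n, 'k::comm_semiring_1) mpoly \<Rightarrow> ('n, 'k) mpoly" where
  "partial_deriv i F =
     (\<Sum>m\<in>Poly_Mapping.keys F.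
        Poly_Mapping.single (m - Poly_Mapping.single i 1)
          (of_nat (Poly_Mapping.lookup m i) * Poly_Mapping.lookup F m))"

lemma lookup_partial_deriv:
  fixes F :: "('n, 'k::comm_semiring_1) mpoly"
  shows "Poly_Mapping.lookup (partial_deriv i F) m =
     of_nat (Poly_Mapping.lookup m i + 1) * Poly_Mapping.lookup F (m + Poly_Mapping.single i 1)"
    (is "_ = ?r")
proof -
  let ?e = "Poly_Mapping.single i (1::nat)"
  have shift: "x = m + ?e" if "x - ?e = m" "Poly_Mapping.lookup x i \<noteq> 0" for x
    using that by (intro poly_mapping_eqI) (auto simp: lookup_add lookup_minus lookup_single when_def)
  have "Poly_Mapping.lookup (partial_deriv i F) m =
     (\<Sum>x\<in>Poly_Mapping.keys F.
        (of_nat (Poly_Mapping.lookup x i) * Poly_Mapping.lookup F x) when x - ?e = m)"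
    by (simp add: partial_deriv_def lookup_sum lookup_single)
  also have "\<dots> = (\<Sum>x\<in>Poly_Mapping.keys F. if x = m + ?e then ?r else 0)"
  proof (intro sum.cong refl)
    fix x
    show "((of_nat (Poly_Mapping.lookup x i) * Poly_Mapping.lookup F x) when x - ?e = m) =
        (if x = m + ?e then ?r else 0)"
    proof (cases "x = m + ?e")
      case True
      then show ?thesis by (simp add: lookup_add lookup_single)
    next
      case False
      then have "x - ?e \<noteq> m \<or> Poly_Mapping.lookup x i = 0" using shift by blast
      then show ?thesis using False by (auto simp: when_def)
    qed
  qed
  also have "\<dots> = ?r"
    by (auto simp: in_keys_iff)
  finally show ?thesis .
qed

definition has_collapse :: "nat \<Rightarrow> ('n::finite, 'k::comm_semiring_1) mpoly \<Rightarrow> bool" where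
  "has_collapse k F \<longleftrightarrow>
     (\<exists>G H. F = (\<Sum>i<k. G i * H i) \<and>
       (\<forall>i<k.
          (G i = 0 \<or>
             0 < total_degree (G i) \<and> total_degree (G i) < total_degree F \<and>
             is_form (total_degree (G i)) (G i)) \<and>
          (H i = 0 \<or> is_form (total_degree F - total_degree (G i)) (H i))))"

definition strong :: "nat \<Rightarrow> ('n::finite, 'k::comm_semiring_1) mpoly \<Rightarrow> bool" where
  "strong k F \<longleftrightarrow> \<not> has_collapse k F"

text \<open>
  The height of a prime ideal \<open>P\<close> is the supremum of the lengths \<open>n\<close> of chains of prime ideals
  \<open>C 0 \<subset> \<dots> \<subset> C n = P\<close>; the height of an ideal is the infimum of the heights of the primes
  containing it (hence infinite for the unit ideal).
\<close>

definition prime_height :: "('a, 'b) ring_scheme \<Rightarrow> 'a set \<Rightarrow> enat" where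
  "prime_height R P =
     Sup {enat n | n. \<exists>C. (\<forall>i\<le>n. primeideal (C i) R) \<and> (\<forall>i<n. C i \<subset> C (Suc i)) \<and> C n = P}"

definition ideal_height :: "('a, 'b) ring_scheme \<Rightarrow> 'a set \<Rightarrow> enat" where
  "ideal_height R I = Inf {prime_height R P | P. primeideal P R \<and> I \<subseteq> P}"

definition jacobian_ideal :: "('n::finite, 'k::comm_ring_1) mpoly \<Rightarrow> ('n, 'k) mpoly set" where
  "jacobian_ideal F =
     Idl\<^bsub>ring_of_type_algebra\<^esub> (insert F (range (\<lambda>i. partial_deriv i F)))"

end

theory Submission
  imports Defs
begin

text \<open>
  Suppose that the height of the Jacobian ideal is less than \<open>k\<close>. Then some prime \<open>P\<close> of height
  \<open>c < k\<close> contains all partial derivatives of \<open>F\<close>; its variety \<open>V\<close> has codimension at most \<open>c\<close>, and all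
  partial derivatives vanish on \<open>V\<close>. Differentiating these equations twice along vector fields
  tangent to \<open>V\<close> shows that the third polar form of \<open>F\<close> vanishes on the tangent space \<open>T\<close> of \<open>V\<close> at a
  general point (\<open>third_polar_vanishes\<close>). Modulo the at most \<open>c\<close> linear equations of \<open>T\<close>, the form \<open>F\<close> is
  therefore congruent to a cubic form on \<open>T\<close> without monomials \<open>x\<^sub>i x\<^sub>j x\<^sub>l\<close> in distinct variables.

  In characteristic \<open>3\<close> the monomials \<open>x\<^sub>i\<^sup>2 x\<^sub>j\<close> with \<open>i \<noteq> j\<close> drop out as well, a combination of cubes is the
  cube of one linear form, and \<open>F\<close> has a collapse with \<open>c + 1 \<le> k \<le> 2 k\<^sup>2 - k\<close> summands. In
  characteristic \<open>2\<close> the restriction of \<open>F\<close> to \<open>T\<close> is \<open>\<Sum>\<^sub>j M\<^sub>j\<^sup>2 x\<^sub>j\<close> with linear forms \<open>M\<^sub>j\<close>, whose squares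
  are the restrictions to \<open>T\<close> of derivatives of \<open>F\<close> and hence lie in \<open>P\<close> modulo the equations of \<open>T\<close>.
  If the \<open>M\<^sub>j\<close> have rank \<open>q\<close>, the polynomial ring modulo \<open>P\<close> is therefore finite over a polynomial ring
  with \<open>q\<close> variables less; since its dimension drops by at most \<open>c\<close>, this forces \<open>q \<le> c\<close>. The dimensions
  are compared by counting monomials (\<open>card_squares_le\<close>). The result is a collapse with
  \<open>c + q \<le> 2 c \<le> 2 (k - 1) (2 k + 1)\<close> summands.

  The dimension theory that is needed rests on one device. For a prime \<open>P\<close> and a variable \<open>x\<^sub>i\<close>, the
  extension \<open>elim i P\<close> of \<open>P \<inter> K[x\<^sub>j | j \<noteq> i]\<close> is again prime, and eliminating all variables in turn
  ends with the zero ideal. The eliminations that change the ideal form a chain of primes, and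
  the height is used only as a bound for the length of this chain (\<open>prime_elim_induct\<close>). Going up
  the chain again, one obtains a set of variables that are algebraically independent modulo \<open>P\<close>
  (\<open>prime_contains_no_free\<close>), sufficiently many independent tangent vector fields
  (\<open>ex_tangent_frame\<close>), and points at which a given function outside \<open>P\<close> does not vanish
  (\<open>nullstellensatz_prime\<close>). In each case a changing step is governed by the minimal polynomial of
  \<open>x\<^sub>i\<close> modulo \<open>P\<close>.
\<close>

section \<open>Polynomials in finitely many variables\<close>

definition const :: "'k::zero \<Rightarrow> ('n, 'k) mpoly" where
  "const c = Poly_Mapping.single 0 c"

definition var :: "'n \<Rightarrow> ('n, 'k::zero_neq_one) mpoly" where
  "var i = Poly_Mapping.single (Poly_Mapping.single i 1) 1"

lemma const_0 [simp]: "const 0 = 0"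
  by (simp add: const_def)

lemma const_1 [simp]: "const 1 = 1"
  by (simp add: const_def)

lemma const_add: "const (a + b) = const a + const b"
  by (simp add: const_def single_add)

lemma const_mult: "const (a * b) = const a * (const b :: ('n, 'k::semiring_0) mpoly)"
  by (simp add: const_def mult_single)

lemma const_uminus: "const (- a) = - (const a :: ('n, 'k::ab_group_add) mpoly)"
  by (simp add: const_def single_uminus)

lemma const_sum: "const (sum f A) = (\<Sum>a\<in>A. const (f a))"
  by (induction A rule: infinite_finite_induct) (simp_all add: const_add)

lemma const_power: "const (a ^ n) = (const (a :: 'k::comm_semiring_1) :: ('n, 'k) mpoly) ^ n"
  by (induction n) (simp_all add: const_mult)

lemma const_of_nat: "const (of_nat n :: 'k::comm_semiring_1) = (of_nat n :: ('n, 'k) mpoly)"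
  by (induction n) (simp_all add: const_add)

lemma mpoly_sum_single:
  "(\<Sum>m\<in>Poly_Mapping.keys F. Poly_Mapping.single m (Poly_Mapping.lookup F m)) = (F :: 'a \<Rightarrow>\<^sub>0 'b::comm_monoid_add)"
  by (rule poly_mapping_eqI)
     (simp add: lookup_sum lookup_single when_def in_keys_iff)

lemma mpoly_single_induct [case_names single add]:
  assumes "\<And>m c. P (Poly_Mapping.single m c)" "\<And>a b. P a \<Longrightarrow> P b \<Longrightarrow> P (a + b)"
  shows "P (F :: 'a \<Rightarrow>\<^sub>0 'b::comm_monoid_add)"
proof -
  have "P (\<Sum>m\<in>A. Poly_Mapping.single m (Poly_Mapping.lookup F m))" if "finite A" for A
    using that
  proof (induction A)
    case empty
    show ?case using assms(1)[of undefined 0] by simp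
  qed (simp add: assms)
  from this[of "Poly_Mapping.keys F"] show ?thesis by (simp add: mpoly_sum_single)
qed

lemma exponent_sum_single:
  "(\<Sum>i\<in>UNIV. Poly_Mapping.single i (Poly_Mapping.lookup m i)) = (m :: 'n::finite \<Rightarrow>\<^sub>0 nat)"
  by (rule poly_mapping_eqI) (simp add: lookup_sum lookup_single when_def)

lemma var_power:
  "(var i :: ('n, 'k::comm_semiring_1) mpoly) ^ n = Poly_Mapping.single (Poly_Mapping.single i n) 1"
  by (induction n) (simp_all add: var_def mult_single flip: single_add)

lemma single_eq_prod_var:
  fixes m :: "'n::finite \<Rightarrow>\<^sub>0 nat" and c :: "'k::comm_semiring_1"
  shows "Poly_Mapping.single m c = const c * (\<Prod>i\<in>UNIV. var i ^ Poly_Mapping.lookup m i)"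
proof -
  have "(\<Prod>i\<in>A. var i ^ Poly_Mapping.lookup m i) =
      Poly_Mapping.single (\<Sum>i\<in>A. Poly_Mapping.single i (Poly_Mapping.lookup m i)) (1::'k)"
    if "finite A" for A
    using that by (induction A) (simp_all add: var_power mult_single)
  from this[of UNIV] show ?thesis
    by (simp add: exponent_sum_single const_def mult_single)
qed

text \<open>
  Polynomial identities that are compatible with sums and products need only be checked on
  constants and variables.
\<close>

lemma mpoly_induct [case_names const var add mult]:
  fixes F :: "('n::finite, 'k::comm_semiring_1) mpoly"
  assumes const: "\<And>c. P (const c)" and var: "\<And>i. P (var i)"
    and add: "\<And>a b. P a \<Longrightarrow> P b \<Longrightarrow> P (a + b)" and mult: "\<And>a b. P a \<Longrightarrow> P b \<Longrightarrow> P (a * b)"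
  shows "P F"
proof (induction F rule: mpoly_single_induct)
  case (single m c)
  have 1: "P 1" using const[of 1] by simp
  have pow: "P (var i ^ n)" for i n
    by (induction n) (simp_all add: 1 var mult)
  have "P (\<Prod>i\<in>A. var i ^ Poly_Mapping.lookup m i)" if "finite A" for A
    using that by (induction A) (simp_all add: 1 pow mult)
  then show ?case by (simp add: single_eq_prod_var const mult)
qed (rule add)

text \<open>
  The universal property of the polynomial ring. It is used with three targets: the field itself
  (evaluation at a point), the polynomial ring (substitution), and univariate polynomials over
  the polynomial ring (singling out one variable).
\<close>

locale coeff_hom =
  fixes h :: "'k::comm_semiring_1 \<Rightarrow> 'b::comm_semiring_1"
  assumes hom_0: "h 0 = 0" and hom_1: "h 1 = 1"
    and hom_add: "h (x + y) = h x + h y" and hom_mult: "h (x * y) = h x * h y"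
begin

definition insertion :: "('n::finite \<Rightarrow> 'b) \<Rightarrow> ('n, 'k) mpoly \<Rightarrow> 'b" where
  "insertion a F =
     (\<Sum>m\<in>Poly_Mapping.keys F. h (Poly_Mapping.lookup F m) * (\<Prod>i\<in>UNIV. a i ^ Poly_Mapping.lookup m i))"

lemma insertion_superset:
  assumes "finite A" "Poly_Mapping.keys F \<subseteq> A"
  shows "insertion a F = (\<Sum>m\<in>A. h (Poly_Mapping.lookup F m) * (\<Prod>i\<in>UNIV. a i ^ Poly_Mapping.lookup m i))"
  unfolding insertion_def using assms
  by (intro sum.mono_neutral_left) (auto simp: in_keys_iff hom_0)

lemma insertion_single:
  "insertion a (Poly_Mapping.single m c) = h c * (\<Prod>i\<in>UNIV. a i ^ Poly_Mapping.lookup m i)"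
  by (subst insertion_superset[where A = "{m}"]) auto

lemma insertion_add: "insertion a (F + G) = insertion a F + insertion a G"
proof -
  let ?A = "Poly_Mapping.keys F \<union> Poly_Mapping.keys G"
  have "Poly_Mapping.keys (F + G) \<subseteq> ?A" by (rule Poly_Mapping.keys_add)
  then show ?thesis
    by (simp add: insertion_superset[of ?A] lookup_add hom_add distrib_right sum.distrib)
qed

lemma insertion_mult: "insertion a (F * G) = insertion a F * insertion a G"
proof (induction F rule: mpoly_single_induct)
  case (single m c)
  show ?case
  proof (induction G rule: mpoly_single_induct)
    case (single m' c')
    show ?case
      by (simp add: mult_single insertion_single lookup_add power_add hom_mult prod.distrib mult_ac)
  qed (simp add: algebra_simps insertion_add)
qed (simp add: algebra_simps insertion_add)

lemma insertion_const [simp]: "insertion a (const c) = h c"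
  by (simp add: const_def insertion_single)

lemma insertion_var [simp]: "insertion a (var i) = a i"
proof -
  have "(\<Prod>j\<in>UNIV. a j ^ Poly_Mapping.lookup (Poly_Mapping.single i 1) j) = (\<Prod>j\<in>UNIV. if j = i then a j else 1)"
    by (intro prod.cong) (auto simp: lookup_single when_def)
  then show ?thesis by (simp add: var_def insertion_single hom_1)
qed

lemma insertion_0 [simp]: "insertion a 0 = 0"
  by (simp add: insertion_def)

lemma insertion_1 [simp]: "insertion a 1 = 1"
  using insertion_const[of a 1] by (simp add: hom_1)

lemma insertion_sum: "insertion a (sum f A) = (\<Sum>x\<in>A. insertion a (f x))"
  by (induction A rule: infinite_finite_induct) (simp_all add: insertion_add)

lemma insertion_power: "insertion a (F ^ n) = insertion a F ^ n"
  by (induction n) (simp_all add: insertion_mult)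

end

interpretation ev: coeff_hom "\<lambda>c :: 'k::comm_semiring_1. c"
  by unfold_locales auto

abbreviation eval :: "('n::finite \<Rightarrow> 'k::comm_semiring_1) \<Rightarrow> ('n, 'k) mpoly \<Rightarrow> 'k" where
  "eval \<equiv> ev.insertion"

interpretation sb: coeff_hom "const :: 'k::comm_semiring_1 \<Rightarrow> ('n::finite, 'k) mpoly"
  by unfold_locales (auto simp: const_add const_mult)

abbreviation msubst ::
    "('n::finite \<Rightarrow> ('n, 'k::comm_semiring_1) mpoly) \<Rightarrow> ('n, 'k) mpoly \<Rightarrow> ('n, 'k) mpoly" where
  "msubst \<equiv> sb.insertion"

interpretation up: coeff_hom "\<lambda>c. [:const c :: ('n::finite, 'k::comm_semiring_1) mpoly:]"
  by unfold_locales (auto simp: const_add const_mult one_pCons mult.commute)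

text \<open>
  A polynomial rewritten as a univariate polynomial in its \<open>i\<close>-th variable. The coefficients stay
  in the full polynomial ring, although they do not contain that variable; this avoids a change
  of type whenever a variable is eliminated.
\<close>

definition upoly :: "'n::finite \<Rightarrow> ('n, 'k::comm_semiring_1) mpoly \<Rightarrow> ('n, 'k) mpoly poly" where
  "upoly i = up.insertion (\<lambda>j. if j = i then [:0, 1:] else [:var j:])"

lemma upoly_const [simp]: "upoly i (const c) = [:const c:]"
  and upoly_var: "upoly i (var j) = (if j = i then [:0, 1:] else [:var j:])"
  and upoly_add: "upoly i (F + G) = upoly i F + upoly i G"
  and upoly_mult: "upoly i (F * G) = upoly i F * upoly i G"
  and upoly_0 [simp]: "upoly i 0 = 0"
  and upoly_1 [simp]: "upoly i 1 = 1"
  and upoly_sum: "upoly i (sum f A) = (\<Sum>x\<in>A. upoly i (f x))"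
  and upoly_power: "upoly i (F ^ n) = upoly i F ^ n"
  by (simp_all add: upoly_def up.insertion_add up.insertion_mult up.insertion_sum up.insertion_power)

lemma upoly_uminus: "upoly i (- F) = - upoly i (F :: ('n::finite, 'k::comm_ring_1) mpoly)"
  using upoly_add[of i F "-F"] by (simp add: eq_neg_iff_add_eq_0 add.commute)

lemma upoly_diff: "upoly i (F - G) = upoly i F - upoly i (G :: ('n::finite, 'k::comm_ring_1) mpoly)"
  using upoly_add[of i F "-G"] by (simp add: upoly_uminus)

lemma poly_upoly: "poly (upoly i F) (var i) = F"
  by (induction F rule: mpoly_induct) (simp_all add: upoly_var upoly_add upoly_mult)

definition xcoeff :: "'n::finite \<Rightarrow> nat \<Rightarrow> ('n, 'k::comm_semiring_1) mpoly \<Rightarrow> ('n, 'k) mpoly" where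
  "xcoeff i n F = Polynomial.coeff (upoly i F) n"

lemma xcoeff_add: "xcoeff i n (F + G) = xcoeff i n F + xcoeff i n G"
  by (simp add: xcoeff_def upoly_add)

lemma upoly_var_power: "upoly i (var i ^ n) = Polynomial.monom 1 n"
  by (simp add: upoly_power upoly_var monom_altdef)

lemma upoly_single:
  fixes m :: "'n::finite \<Rightarrow>\<^sub>0 nat" and c :: "'k::comm_semiring_1"
  shows "upoly i (Poly_Mapping.single m c) =
     Polynomial.monom (Poly_Mapping.single (m - Poly_Mapping.single i (Poly_Mapping.lookup m i)) c)
       (Poly_Mapping.lookup m i)"
proof -
  have 1: "Poly_Mapping.single m c =
     Poly_Mapping.single (m - Poly_Mapping.single i (Poly_Mapping.lookup m i)) c * var i ^ Poly_Mapping.lookup m i"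
    by (subst var_power) (auto simp: mult_single lookup_minus lookup_add lookup_single when_def
      intro!: arg_cong2[where f = Poly_Mapping.single] poly_mapping_eqI)
  have 2: "upoly i (Poly_Mapping.single m' c) = [:Poly_Mapping.single m' c:]"
    if "Poly_Mapping.lookup m' i = 0" for m'
  proof -
    have "(\<Prod>j\<in>A. (if j = i then [:0, 1:] else [:var j :: ('n, 'k) mpoly:]) ^ Poly_Mapping.lookup m' j) =
        [:\<Prod>j\<in>A. var j ^ Poly_Mapping.lookup m' j:]" if "finite A" for A
      using that
    proof (induction A)
      case (insert x A)
      have "[:var x :: ('n, 'k) mpoly:] ^ k = [:var x ^ k:]" for k
        by (induction k) (simp_all add: one_pCons mult.commute)
      with insert \<open>Poly_Mapping.lookup m' i = 0\<close> show ?case by (auto simp: mult.commute)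
    qed (simp add: one_pCons)
    from this[of UNIV] show ?thesis
      unfolding upoly_def up.insertion_single
      by (simp add: mult.commute) (simp add: single_eq_prod_var[of m' c] mult.commute)
  qed
  show ?thesis
    by (subst 1) (simp add: upoly_mult 2 upoly_var_power lookup_minus smult_monom)
qed

text \<open>
  This formula on exponent vectors turns freeness and commutation statements about \<open>xcoeff\<close> into
  bookkeeping.
\<close>

lemma lookup_xcoeff:
  "Poly_Mapping.lookup (xcoeff i n F) m =
     (if Poly_Mapping.lookup m i = 0 then Poly_Mapping.lookup F (m + Poly_Mapping.single i n) else 0)"
proof (induction F rule: mpoly_single_induct)
  case (single m' c)
  have "m' - Poly_Mapping.single i (Poly_Mapping.lookup m' i) = m \<and> Poly_Mapping.lookup m' i = n \<longleftrightarrow>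
     Poly_Mapping.lookup m i = 0 \<and> m' = m + Poly_Mapping.single i n"
    (is "?L \<longleftrightarrow> ?R")
  proof
    assume ?L
    then show ?R
      by (auto simp: lookup_minus lookup_add lookup_single when_def intro!: poly_mapping_eqI)
  next
    assume ?R
    then show ?L
      by (auto simp: lookup_minus lookup_add lookup_single when_def intro!: poly_mapping_eqI)
  qed
  then show ?case
    by (auto simp: xcoeff_def upoly_single lookup_single when_def)
qed (simp add: xcoeff_add lookup_add)

definition free_of :: "'n::finite \<Rightarrow> ('n, 'k::comm_semiring_1) mpoly \<Rightarrow> bool" where
  "free_of i F \<longleftrightarrow> (\<forall>m. Poly_Mapping.lookup m i \<noteq> 0 \<longrightarrow> Poly_Mapping.lookup F m = 0)"

lemma upoly_free:
  assumes "free_of i F"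
  shows "upoly i F = [:F:]"
proof -
  have "xcoeff i n F = Polynomial.coeff [:F:] n" for n
    using assms
    by (intro poly_mapping_eqI) (auto simp: lookup_xcoeff coeff_pCons free_of_def lookup_add split: nat.splits)
  then show ?thesis by (simp add: poly_eq_iff xcoeff_def)
qed

lemma free_of_iff_upoly: "free_of i F \<longleftrightarrow> upoly i F = [:F:]"
proof
  assume "upoly i F = [:F:]"
  then have "xcoeff i 0 F = F" by (simp add: xcoeff_def)
  then show "free_of i F"
    by (metis free_of_def lookup_xcoeff)
qed (rule upoly_free)

lemma free_of_xcoeff: "free_of i (xcoeff i n F)"
  by (simp add: free_of_def lookup_xcoeff)

lemma free_of_xcoeff_other: "free_of j F \<Longrightarrow> free_of j (xcoeff i n F)"
  by (auto simp: free_of_def lookup_xcoeff lookup_add)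

lemma xcoeff_commute: "i \<noteq> j \<Longrightarrow> xcoeff i n (xcoeff j k F) = xcoeff j k (xcoeff i n F)"
  by (rule poly_mapping_eqI) (simp add: lookup_xcoeff lookup_add lookup_single add_ac)

lemma free_of_add: "free_of i F \<Longrightarrow> free_of i G \<Longrightarrow> free_of i (F + G)"
  by (simp add: free_of_def lookup_add)

lemma free_of_mult: "free_of i F \<Longrightarrow> free_of i G \<Longrightarrow> free_of i (F * G)"
  by (simp add: free_of_iff_upoly upoly_mult mult.commute)

lemma free_of_const [simp]: "free_of i (const c)"
  by (simp add: free_of_iff_upoly)

lemma free_of_var: "i \<noteq> j \<Longrightarrow> free_of i (var j)"
  by (simp add: free_of_iff_upoly upoly_var)

lemma free_of_sum: "(\<And>x. x \<in> A \<Longrightarrow> free_of i (f x)) \<Longrightarrow> free_of i (sum f A)"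
  by (induction A rule: infinite_finite_induct) (simp_all add: free_of_add, simp_all add: free_of_def)

lemma upoly_xcoeff: "upoly i (xcoeff i n F) = [:xcoeff i n F:]"
  by (simp add: upoly_free free_of_xcoeff)

lemma mpoly_eq_sum_xcoeff:
  "F = (\<Sum>n\<le>Polynomial.degree (upoly i F). xcoeff i n F * var i ^ n)"
  using poly_altdef[of "upoly i F" "var i"] by (simp add: poly_upoly xcoeff_def)

section \<open>Partial derivatives and polynomial vector fields\<close>

lemma partial_deriv_add: "partial_deriv i (F + G) = partial_deriv i F + partial_deriv i G"
  by (rule poly_mapping_eqI) (simp add: lookup_partial_deriv lookup_add distrib_left)

lemma partial_deriv_0 [simp]: "partial_deriv i 0 = 0"
  by (simp add: partial_deriv_def)

lemma partial_deriv_sum: "partial_deriv i (sum f A) = (\<Sum>x\<in>A. partial_deriv i (f x))"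
  by (induction A rule: infinite_finite_induct) (simp_all add: partial_deriv_add)

lemma partial_deriv_single:
  "partial_deriv i (Poly_Mapping.single m c) =
     Poly_Mapping.single (m - Poly_Mapping.single i 1) (of_nat (Poly_Mapping.lookup m i) * c)"
  by (simp add: partial_deriv_def)

lemma partial_deriv_const [simp]: "partial_deriv i (const c) = 0"
  by (simp add: const_def partial_deriv_single)

lemma partial_deriv_var: "partial_deriv i (var j) = (if i = j then 1 else 0)"
  by (simp add: var_def partial_deriv_single lookup_single)

lemma partial_deriv_mult:
  "partial_deriv i (F * G) = partial_deriv i F * G + F * partial_deriv i G"
proof (induction F rule: mpoly_single_induct)
  case (single m c)
  show ?case
  proof (induction G rule: mpoly_single_induct)
    case (single m' c')
    let ?e = "Poly_Mapping.single i (1::nat)"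
    have shift: "x - ?e + y = x + y - ?e" if "Poly_Mapping.lookup x i \<noteq> 0" for x y
      using that by (intro poly_mapping_eqI) (auto simp: lookup_minus lookup_add lookup_single when_def)
    have 1: "Poly_Mapping.single (m - ?e + m') (of_nat (Poly_Mapping.lookup m i) * (c * c')) =
        Poly_Mapping.single (m + m' - ?e) (of_nat (Poly_Mapping.lookup m i) * (c * c'))"
      by (cases "Poly_Mapping.lookup m i = 0") (use shift[of m m'] in simp_all)
    have 2: "Poly_Mapping.single (m + (m' - ?e)) (of_nat (Poly_Mapping.lookup m' i) * (c * c')) =
        Poly_Mapping.single (m + m' - ?e) (of_nat (Poly_Mapping.lookup m' i) * (c * c'))"
      using shift[of m' m] by (cases "Poly_Mapping.lookup m' i = 0") (simp_all add: add_ac)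
    have "partial_deriv i (Poly_Mapping.single m c) * Poly_Mapping.single m' c' =
        Poly_Mapping.single (m + m' - ?e) (of_nat (Poly_Mapping.lookup m i) * (c * c'))"
      using 1 by (simp add: partial_deriv_single mult_single mult.assoc)
    moreover have "Poly_Mapping.single m c * partial_deriv i (Poly_Mapping.single m' c') =
        Poly_Mapping.single (m + m' - ?e) (of_nat (Poly_Mapping.lookup m' i) * (c * c'))"
      using 2 by (simp add: partial_deriv_single mult_single mult_ac)
    ultimately show ?case
      by (simp add: mult_single partial_deriv_single lookup_add distrib_right flip: single_add)
  qed (simp add: algebra_simps partial_deriv_add)
qed (simp add: algebra_simps partial_deriv_add)

lemma partial_deriv_commute: "partial_deriv i (partial_deriv j F) = partial_deriv j (partial_deriv i F)"
proof (rule poly_mapping_eqI)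
  fix m
  show "Poly_Mapping.lookup (partial_deriv i (partial_deriv j F)) m =
      Poly_Mapping.lookup (partial_deriv j (partial_deriv i F)) m"
    by (cases "i = j") (auto simp: lookup_partial_deriv lookup_add lookup_single add.assoc mult.left_commute
      add.commute[of "Poly_Mapping.single i (Suc 0)"])
qed

lemma free_of_partial_deriv: "free_of j F \<Longrightarrow> free_of j (partial_deriv i F)"
  by (auto simp: free_of_def lookup_partial_deriv lookup_add)

text \<open>
  The derivation \<open>\<Sum>\<^sub>l u\<^sub>l \<partial>/\<partial>x\<^sub>l\<close>, that is, a polynomial vector field acting on polynomials.
\<close>

definition vfield :: "('n::finite \<Rightarrow> ('n, 'k::comm_semiring_1) mpoly) \<Rightarrow> ('n, 'k) mpoly \<Rightarrow> ('n, 'k) mpoly" where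
  "vfield u F = (\<Sum>l\<in>UNIV. u l * partial_deriv l F)"

lemma vfield_add: "vfield u (F + G) = vfield u F + vfield u G"
  by (simp add: vfield_def partial_deriv_add distrib_left sum.distrib)

lemma vfield_0 [simp]: "vfield u 0 = 0"
  by (simp add: vfield_def)

lemma vfield_const [simp]: "vfield u (const c) = 0"
  by (simp add: vfield_def)

lemma vfield_sum: "vfield u (sum f A) = (\<Sum>x\<in>A. vfield u (f x))"
  by (induction A rule: infinite_finite_induct) (simp_all add: vfield_add)

lemma vfield_mult: "vfield u (F * G) = vfield u F * G + F * vfield u G"
  by (simp add: vfield_def partial_deriv_mult sum_distrib_left sum_distrib_right sum.distrib algebra_simps)

lemma vfield_var [simp]: "vfield u (var i) = u i"
  by (simp add: vfield_def partial_deriv_var if_distrib cong: if_cong)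

section \<open>Prime ideals, elimination of a variable, and height\<close>

abbreviation is_prime :: "'a::comm_ring_1 set \<Rightarrow> bool" where
  "is_prime P \<equiv> primeideal P ring_of_type_algebra"

text \<open>
  Over the ring of a type every element belongs to the carrier, so the carrier-based notion of a
  prime ideal reduces to the usual closure properties.
\<close>

lemma is_prime_iff:
  "is_prime (P :: 'a::comm_ring_1 set) \<longleftrightarrow>
     0 \<in> P \<and> (\<forall>a\<in>P. \<forall>b\<in>P. a + b \<in> P) \<and> (\<forall>a\<in>P. \<forall>r. r * a \<in> P) \<and> 1 \<notin> P \<and>
     (\<forall>a b. a * b \<in> P \<longrightarrow> a \<in> P \<or> b \<in> P)"
  (is "?L \<longleftrightarrow> ?R")
proof
  let ?A = "ring_of_type_algebra :: 'a ring"
  have sel: "carrier ?A = UNIV" "(\<otimes>\<^bsub>?A\<^esub>) = (*)" "(\<oplus>\<^bsub>?A\<^esub>) = (+)" "\<one>\<^bsub>?A\<^esub> = 1" "\<zero>\<^bsub>?A\<^esub> = 0"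
    by (simp_all add: ring_of_type_algebra_def fun_eq_iff)
  {
    assume L: ?L
    then interpret primeideal P ?A .
    show ?R
    proof (intro conjI ballI allI impI)
      show "0 \<in> P" using additive_subgroup.zero_closed[OF additive_subgroup_axioms] by (simp add: sel)
      show "a + b \<in> P" if "a \<in> P" "b \<in> P" for a b using additive_subgroup.a_closed[OF additive_subgroup_axioms, of a b] that by (simp add: sel)
      show "r * a \<in> P" if "a \<in> P" for a r using I_l_closed[OF that, of r] by (simp add: sel)
      show "1 \<notin> P" using one_imp_carrier I_notcarr by (auto simp: sel)
      show "a \<in> P \<or> b \<in> P" if "a * b \<in> P" for a b using I_prime[of a b] that by (simp add: sel)
    qed
  }
  {
    assume R: ?R
    show ?L
    proof (rule primeidealI)
      have um: "- a \<in> P" if "a \<in> P" for a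
        using R that by (metis mult_minus1)
      show "ideal P ?A"
      proof (rule idealI)
        show "ring ?A" by (rule ring_from_type_algebra)
        have minv: "inv\<^bsub>add_monoid ?A\<^esub> a = - a" for a
        proof -
          interpret ring ?A by (rule ring_from_type_algebra)
          have "\<ominus>\<^bsub>?A\<^esub> a = - a" by (rule minus_equality) (simp_all add: sel)
          then show ?thesis by (simp add: a_inv_def)
        qed
        have invP: "inv\<^bsub>add_monoid ?A\<^esub> a \<in> P" if "a \<in> P" for a
          using um that by (simp only: minv)
        interpret ring ?A by (rule ring_from_type_algebra)
        show "subgroup P (add_monoid ?A)"
          by (rule group.subgroupI)
             (use R invP add.group_axioms in \<open>auto simp: sel\<close>)
      qed (use R in \<open>auto simp: sel mult.commute\<close>)
      show "cring ?A" by (rule cring_from_type_algebra)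
    qed (use R in \<open>auto simp: sel\<close>)
  }
qed

context
  fixes P :: "'a::comm_ring_1 set"
  assumes P: "is_prime P"
begin

lemma prime_0: "0 \<in> P" using P by (simp add: is_prime_iff)
lemma prime_add: "a \<in> P \<Longrightarrow> b \<in> P \<Longrightarrow> a + b \<in> P" using P by (simp add: is_prime_iff)
lemma prime_mult_left: "a \<in> P \<Longrightarrow> r * a \<in> P" using P by (simp add: is_prime_iff)
lemma prime_mult_right: "a \<in> P \<Longrightarrow> a * r \<in> P" using prime_mult_left[of a r] by (simp add: mult.commute)
lemma prime_1: "1 \<notin> P" using P by (simp add: is_prime_iff)
lemma prime_mult_iff: "a * b \<in> P \<longleftrightarrow> a \<in> P \<or> b \<in> P"
  using P prime_mult_left prime_mult_right by (auto simp: is_prime_iff)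
lemma prime_uminus: "a \<in> P \<Longrightarrow> - a \<in> P" using prime_mult_left[of a "-1"] by simp
lemma prime_diff: "a \<in> P \<Longrightarrow> b \<in> P \<Longrightarrow> a - b \<in> P" using prime_add[of a "-b"] prime_uminus by simp
lemma prime_sum: "(\<And>x. x \<in> A \<Longrightarrow> f x \<in> P) \<Longrightarrow> sum f A \<in> P"
  by (induction A rule: infinite_finite_induct) (auto intro: prime_0 prime_add)
lemma prime_power: "a ^ n \<in> P \<Longrightarrow> a \<in> P"
  by (induction n) (auto simp: prime_1 prime_mult_iff)
lemma prime_cancel_add: "a + b \<in> P \<Longrightarrow> b \<in> P \<Longrightarrow> a \<in> P" using prime_diff[of "a + b" b] by simp

end

lemma xcoeff_mult: "xcoeff i n (F * G) = (\<Sum>k\<le>n. xcoeff i k F * xcoeff i (n - k) G)"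
  by (simp add: xcoeff_def upoly_mult coeff_mult)

lemma xcoeff_0 [simp]: "xcoeff i n 0 = 0"
  by (simp add: xcoeff_def)

lemma xcoeff_1: "xcoeff i n 1 = (if n = 0 then 1 else 0)"
  by (simp add: xcoeff_def coeff_1)

lemma xcoeff_free: "free_of i F \<Longrightarrow> xcoeff i n F = (if n = 0 then F else 0)"
  by (simp add: xcoeff_def upoly_free coeff_pCons split: nat.split)

text \<open>
  The ideal generated by \<open>P \<inter> K[x\<^sub>j | j \<noteq> i]\<close>. Geometrically this replaces a variety by the
  cylinder over its projection along the \<open>i\<close>-th axis. For prime \<open>P\<close> it differs from \<open>P\<close> exactly when
  \<open>x\<^sub>i\<close> is algebraic modulo \<open>P\<close> over the remaining variables.
\<close>

definition elim :: "'n::finite \<Rightarrow> ('n, 'k::comm_ring_1) mpoly set \<Rightarrow> ('n, 'k) mpoly set" where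
  "elim i P = {F. \<forall>n. xcoeff i n F \<in> P}"

lemma elim_subset:
  assumes "is_prime P"
  shows "elim i P \<subseteq> P"
proof
  fix F assume "F \<in> elim i P"
  then have "(\<Sum>n\<le>Polynomial.degree (upoly i F). xcoeff i n F * var i ^ n) \<in> P"
    by (intro prime_sum[OF assms] prime_mult_right[OF assms]) (simp add: elim_def)
  then show "F \<in> P" using mpoly_eq_sum_xcoeff[of F i] by simp
qed

lemma elim_free: "is_prime P \<Longrightarrow> free_of i F \<Longrightarrow> F \<in> elim i P \<longleftrightarrow> F \<in> P"
  by (auto simp: elim_def xcoeff_free prime_0)

text \<open>
  Gauss' argument: if neither factor lies in the ideal, then the product of the lowest
  coefficients outside \<open>P\<close> survives modulo \<open>P\<close> in the product.
\<close>

lemma is_prime_elim: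
  fixes P :: "('n::finite, 'k::comm_ring_1) mpoly set"
  assumes P: "is_prime P"
  shows "is_prime (elim i P)"
  unfolding is_prime_iff
proof (intro conjI ballI allI impI)
  show "0 \<in> elim i P" by (simp add: elim_def prime_0[OF P])
  show "a + b \<in> elim i P" if "a \<in> elim i P" "b \<in> elim i P" for a b
    using that by (simp add: elim_def xcoeff_add prime_add[OF P])
  show "r * a \<in> elim i P" if "a \<in> elim i P" for a r
    using that by (auto simp: elim_def xcoeff_mult intro!: prime_sum[OF P] prime_mult_left[OF P])
  show "1 \<notin> elim i P"
    using prime_1[OF P] by (auto simp: elim_def xcoeff_1 intro!: exI[of _ 0])
  show "F \<in> elim i P \<or> G \<in> elim i P" if FG: "F * G \<in> elim i P" for F G
  proof (rule ccontr)
    assume neg: "\<not> (F \<in> elim i P \<or> G \<in> elim i P)"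
    define a where "a = (LEAST n. xcoeff i n F \<notin> P)"
    define b where "b = (LEAST n. xcoeff i n G \<notin> P)"
    have a: "xcoeff i a F \<notin> P" and b: "xcoeff i b G \<notin> P"
      unfolding a_def b_def using neg LeastI_ex[of "\<lambda>n. xcoeff i n F \<notin> P"] LeastI_ex[of "\<lambda>n. xcoeff i n G \<notin> P"]
      by (auto simp: elim_def)
    have a': "xcoeff i n F \<in> P" if "n < a" for n
      using not_less_Least[of n "\<lambda>n. xcoeff i n F \<notin> P"] that by (auto simp: a_def)
    have b': "xcoeff i n G \<in> P" if "n < b" for n
      using not_less_Least[of n "\<lambda>n. xcoeff i n G \<notin> P"] that by (auto simp: b_def)
    have "xcoeff i (a + b) (F * G) =
        xcoeff i a F * xcoeff i b G + (\<Sum>k\<in>{..a + b} - {a}. xcoeff i k F * xcoeff i (a + b - k) G)"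
      by (simp add: xcoeff_mult sum.remove[of "{..a + b}" a])
    moreover have "(\<Sum>k\<in>{..a + b} - {a}. xcoeff i k F * xcoeff i (a + b - k) G) \<in> P"
    proof (rule prime_sum[OF P])
      fix k assume "k \<in> {..a + b} - {a}"
      then have "k < a \<or> a + b - k < b" by auto
      then show "xcoeff i k F * xcoeff i (a + b - k) G \<in> P"
        using a' b' by (auto simp: prime_mult_iff[OF P])
    qed
    moreover have "xcoeff i (a + b) (F * G) \<in> P" using FG by (simp add: elim_def)
    ultimately have "xcoeff i a F * xcoeff i b G \<in> P" by (auto intro: prime_cancel_add[OF P])
    with a b show False by (simp add: prime_mult_iff[OF P])
  qed
qed

lemma elim_idem:
  assumes "is_prime P"
  shows "elim i (elim i P) = elim i P"
  using assms by (auto simp: elim_def xcoeff_free free_of_xcoeff prime_0)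

lemma elim_elim_fixed:
  fixes P :: "('n::finite, 'k::comm_ring_1) mpoly set"
  assumes P: "is_prime P" and j: "elim j P = P"
  shows "elim j (elim i P) = elim i P"
proof (cases "i = j")
  case False
  show ?thesis
  proof
    show "elim j (elim i P) \<subseteq> elim i P" by (rule elim_subset[OF is_prime_elim[OF P]])
    show "elim i P \<subseteq> elim j (elim i P)"
    proof
      fix F assume F: "F \<in> elim i P"
      have "xcoeff i n (xcoeff j k F) \<in> P" for n k
      proof -
        have "xcoeff i n F \<in> elim j P" using F j by (simp add: elim_def)
        then show ?thesis by (simp add: elim_def xcoeff_commute[OF False])
      qed
      then show "F \<in> elim j (elim i P)" by (simp add: elim_def)
    qed
  qed
qed (simp add: elim_idem[OF P])

lemma free_of_all:
  assumes "\<And>l. free_of l (F :: ('n::finite, 'k::comm_semiring_1) mpoly)"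
  shows "F = const (Poly_Mapping.lookup F 0)"
proof (rule poly_mapping_eqI)
  fix m :: "'n \<Rightarrow>\<^sub>0 nat"
  show "Poly_Mapping.lookup F m = Poly_Mapping.lookup (const (Poly_Mapping.lookup F 0)) m"
  proof (cases "m = 0")
    case False
    then obtain l where "Poly_Mapping.lookup m l \<noteq> 0" by (metis lookup_zero poly_mapping_eqI)
    then have "Poly_Mapping.lookup F m = 0" using assms[of l] by (simp add: free_of_def)
    with False show ?thesis by (simp add: const_def lookup_single)
  qed (simp add: const_def)
qed

lemma const_in_prime:
  fixes P :: "('n::finite, 'k::field) mpoly set"
  assumes "is_prime P" "const c \<in> P"
  shows "c = 0"
proof (rule ccontr)
  assume "c \<noteq> 0"
  then have "const (inverse c) * const c = (1 :: ('n, 'k) mpoly)" by (simp flip: const_mult)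
  with prime_mult_left[OF assms, of "const (inverse c)"] prime_1[OF assms(1)] show False by simp
qed

text \<open>
  A nonzero element of \<open>P\<close> with as few variables as possible would be constant: otherwise its
  coefficients with respect to one of its variables lie in \<open>P\<close> and involve fewer variables.
\<close>

lemma elim_all_fixed:
  fixes P :: "('n::finite, 'k::field) mpoly set"
  assumes P: "is_prime P" and fixed: "\<And>l. elim l P = P"
  shows "P = {0}"
proof -
  have "F = 0" if "F \<in> P" for F
    using that
  proof (induction "card {l. \<not> free_of l F}" arbitrary: F rule: less_induct)
    case less
    show ?case
    proof (cases "\<forall>l. free_of l F")
      case True
      then show ?thesis
        using free_of_all[of F] const_in_prime[OF P] less.prems by (metis const_0)
    next
      case False
      then obtain l where l: "\<not> free_of l F" by blast
      have "xcoeff l n F = 0" for n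
      proof (rule less.hyps)
        have "{j. \<not> free_of j (xcoeff l n F)} \<subset> {j. \<not> free_of j F}"
          using l free_of_xcoeff free_of_xcoeff_other by blast
        then show "card {j. \<not> free_of j (xcoeff l n F)} < card {j. \<not> free_of j F}"
          by (intro psubset_card_mono) auto
        show "xcoeff l n F \<in> P" using less.prems fixed[of l] by (auto simp: elim_def)
      qed
      then show ?thesis using mpoly_eq_sum_xcoeff[of F l] by simp
    qed
  qed
  then show ?thesis using prime_0[OF P] by auto
qed

definition prime_chain :: "nat \<Rightarrow> 'a::comm_ring_1 set \<Rightarrow> bool" where
  "prime_chain m P \<longleftrightarrow>
     (\<exists>C. (\<forall>i\<le>m. is_prime (C i)) \<and> (\<forall>i<m. C i \<subset> C (Suc i)) \<and> C m = P)"

lemma prime_chain_height: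
  assumes "prime_chain m P"
  shows "enat m \<le> prime_height ring_of_type_algebra P"
  using assms unfolding prime_chain_def prime_height_def by (intro Sup_upper) blast

lemma prime_chain_0: "is_prime P \<Longrightarrow> prime_chain 0 P"
  by (auto simp: prime_chain_def)

lemma prime_chain_Suc:
  assumes "prime_chain m Q" "Q \<subset> P" "is_prime P"
  shows "prime_chain (Suc m) P"
proof -
  obtain C where C: "\<forall>i\<le>m. is_prime (C i)" "\<forall>i<m. C i \<subset> C (Suc i)" "C m = Q"
    using assms(1) by (auto simp: prime_chain_def)
  show ?thesis
    unfolding prime_chain_def
    by (rule exI[of _ "C(Suc m := P)"]) (use C assms in \<open>auto simp: le_Suc_eq less_Suc_eq\<close>)
qed

text \<open>
  Eliminating the variables one after the other leads from \<open>P\<close> down to the zero ideal. Each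
  elimination that changes the ideal is a proper inclusion of primes, so the number of such
  steps is the length of a chain below \<open>P\<close>.
\<close>

lemma prime_elim_induct_on:
  fixes P :: "('n::finite, 'k::field) mpoly set" and Q :: "nat \<Rightarrow> ('n, 'k) mpoly set \<Rightarrow> bool"
  assumes "finite V" and "is_prime P" and "\<forall>l. l \<notin> V \<longrightarrow> elim l P = P"
    and base: "is_prime {0 :: ('n, 'k) mpoly} \<Longrightarrow> Q 0 {0}"
    and step: "\<And>P i m. is_prime P \<Longrightarrow> elim i P \<noteq> P \<Longrightarrow> Q m (elim i P) \<Longrightarrow> Q (Suc m) P"
  shows "\<exists>m. prime_chain m P \<and> Q m P"
  using assms(1-3)
proof (induction V arbitrary: P rule: finite_induct)
  case empty
  then have "P = {0}" using elim_all_fixed[of P] by simp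
  with base prime_chain_0 empty.prems show ?case by blast
next
  case (insert i V)
  show ?case
  proof (cases "elim i P = P")
    case True
    with insert.prems have "\<forall>l. l \<notin> V \<longrightarrow> elim l P = P" by auto
    with insert.IH insert.prems show ?thesis by blast
  next
    case False
    have "elim l (elim i P) = elim i P" if "l \<notin> V" for l
      using insert.prems elim_elim_fixed[of P l i] elim_idem[of P i] that by (cases "l = i") auto
    then obtain m where m: "prime_chain m (elim i P)" "Q m (elim i P)"
      using insert.IH[of "elim i P"] is_prime_elim insert.prems by blast
    have "prime_chain (Suc m) P"
      using prime_chain_Suc[OF m(1)] elim_subset insert.prems(1) False by blast
    with step[OF insert.prems(1) False m(2)] show ?thesis by blast
  qed
qed

text \<open>
  The only access to heights in this development. A property of a prime ideal together with a
  number, which holds for \<open>(0, {0})\<close> and is inherited from \<open>elim i P\<close> to \<open>P\<close> at the cost of raising the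
  number by one, holds for \<open>P\<close> with a number that is at most the height.
\<close>

lemma prime_elim_induct:
  fixes P :: "('n::finite, 'k::field) mpoly set" and Q :: "nat \<Rightarrow> ('n, 'k) mpoly set \<Rightarrow> bool"
  assumes "is_prime P"
    and "is_prime {0 :: ('n, 'k) mpoly} \<Longrightarrow> Q 0 {0}"
    and "\<And>P i m. is_prime P \<Longrightarrow> elim i P \<noteq> P \<Longrightarrow> Q m (elim i P) \<Longrightarrow> Q (Suc m) P"
  shows "\<exists>m. enat m \<le> prime_height ring_of_type_algebra P \<and> Q m P"
proof -
  have "\<exists>m. prime_chain m P \<and> Q m P"
  proof (rule prime_elim_induct_on[of UNIV])
    show "Q 0 {0}" if "is_prime {0 :: ('n, 'k) mpoly}" using that by (rule assms(2))
    show "Q (Suc m) P" if "is_prime P" "elim i P \<noteq> P" "Q m (elim i P)" for P i m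
      using that by (rule assms(3))
  qed (simp_all add: assms(1))
  then show ?thesis using prime_chain_height by blast
qed

section \<open>Pseudo-division modulo a prime ideal\<close>

definition xdeg :: "'n::finite \<Rightarrow> ('n, 'k::comm_ring_1) mpoly \<Rightarrow> nat" where
  "xdeg i F = Polynomial.degree (upoly i F)"

definition xlead :: "'n::finite \<Rightarrow> ('n, 'k::comm_ring_1) mpoly \<Rightarrow> ('n, 'k) mpoly" where
  "xlead i F = xcoeff i (xdeg i F) F"

lemma upoly_xlead: "upoly i (xlead i F) = [:xlead i F:]"
  by (simp add: xlead_def upoly_xcoeff)

lemma free_of_xlead: "free_of i (xlead i F)"
  by (simp add: xlead_def free_of_xcoeff)

lemma xdeg_0_free: "xdeg i F = 0 \<Longrightarrow> free_of i F"
  using mpoly_eq_sum_xcoeff[of F i] free_of_xcoeff[of i 0 F] by (simp add: xdeg_def)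

lemma xdeg_lessI:
  assumes "0 < n" "\<And>k. k \<ge> n \<Longrightarrow> xcoeff i k F = 0"
  shows "xdeg i F < n"
proof (rule ccontr)
  assume "\<not> xdeg i F < n"
  then have "xcoeff i (xdeg i F) F = 0" using assms(2) by simp
  then have "upoly i F = 0" by (simp add: xcoeff_def xdeg_def)
  with \<open>\<not> xdeg i F < n\<close> assms(1) show False by (simp add: xdeg_def)
qed

lemma xcoeff_beyond: "xdeg i F < k \<Longrightarrow> xcoeff i k F = 0"
  by (simp add: xcoeff_def xdeg_def coeff_eq_0)

lemma xcoeff_lead_step:
  fixes F G L M :: "('n::finite, 'k::comm_ring_1) mpoly"
  assumes "free_of i L" "free_of i M"
  shows "xcoeff i k (L * F - M * var i ^ e * G) =
     L * xcoeff i k F - M * (if k < e then 0 else xcoeff i (k - e) G)"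
proof -
  have "upoly i (L * F - M * var i ^ e * G) =
      Polynomial.smult L (upoly i F) - Polynomial.smult M (Polynomial.monom 1 e * upoly i G)"
    using assms by (simp add: upoly_diff upoly_mult upoly_free upoly_var_power mult.assoc)
  then show ?thesis by (simp add: xcoeff_def coeff_monom_mult)
qed

lemma xdeg_cancel_lead:
  assumes "xdeg i T \<le> xdeg i G" "0 < xdeg i G"
  shows "xdeg i (xlead i T * G - xlead i G * var i ^ (xdeg i G - xdeg i T) * T) < xdeg i G"
proof (rule xdeg_lessI)
  fix k assume k: "k \<ge> xdeg i G"
  show "xcoeff i k (xlead i T * G - xlead i G * var i ^ (xdeg i G - xdeg i T) * T) = 0"
  proof (cases "k = xdeg i G")
    case True
    with assms show ?thesis
      by (simp add: xcoeff_lead_step free_of_xlead) (simp add: xlead_def)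
  next
    case False
    with k assms show ?thesis
      by (simp add: xcoeff_lead_step free_of_xlead xcoeff_beyond)
  qed
qed (fact assms)

lemma xdeg_drop_lead:
  assumes "0 < xdeg i G"
  shows "xdeg i (G - xlead i G * var i ^ xdeg i G) < xdeg i G"
proof -
  have "xdeg i (1 :: ('a, 'b) mpoly) = 0" "xlead i (1 :: ('a, 'b) mpoly) = 1"
    by (simp_all add: xdeg_def xlead_def xcoeff_1)
  then show ?thesis using xdeg_cancel_lead[of i 1 G] assms by simp
qed

text \<open>
  Division with remainder in the \<open>i\<close>-th variable, where instead of inverting the leading coefficient
  of the divisor one multiplies the dividend by powers of it. The bound on the degree of the
  quotient enters in \<open>free_of_relation\<close>, where the quotient is compared with a minimal polynomial.
\<close>

lemma pseudo_division:
  assumes "0 < xdeg i T"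
  shows "\<exists>m Q. xdeg i (xlead i T ^ m * G - Q * T) < xdeg i T \<and> (Q = 0 \<or> xdeg i Q + xdeg i T \<le> xdeg i G)"
proof (induction "xdeg i G" arbitrary: G rule: less_induct)
  case less
  let ?t = "xlead i T"
  show ?case
  proof (cases "xdeg i G < xdeg i T")
    case True
    then show ?thesis by (intro exI[of _ 0]) simp
  next
    case False
    let ?q = "xlead i G * var i ^ (xdeg i G - xdeg i T)"
    define G' where "G' = ?t * G - ?q * T"
    have dG': "xdeg i G' < xdeg i G"
      unfolding G'_def using False assms by (intro xdeg_cancel_lead) auto
    obtain m Q where mQ: "xdeg i (?t ^ m * G' - Q * T) < xdeg i T" "Q = 0 \<or> xdeg i Q + xdeg i T \<le> xdeg i G'"
      using less[OF dG'] by blast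
    define Q' where "Q' = ?t ^ m * ?q + Q"
    have "?t ^ Suc m * G - Q' * T = ?t ^ m * G' - Q * T"
      by (simp add: G'_def Q'_def algebra_simps)
    moreover have "xdeg i Q' \<le> xdeg i G - xdeg i T"
    proof -
      have "upoly i (?t ^ m * ?q) = Polynomial.monom (?t ^ m * xlead i G) (xdeg i G - xdeg i T)"
        by (simp add: upoly_mult upoly_power[of i "xlead i T"] upoly_xlead mult.commute upoly_var_power smult_monom poly_const_pow)
      then have "xdeg i (?t ^ m * ?q) \<le> xdeg i G - xdeg i T" by (simp add: xdeg_def degree_monom_le)
      moreover have "xdeg i Q \<le> xdeg i G - xdeg i T"
        using mQ(2) dG' by (auto simp: xdeg_def)
      ultimately show ?thesis by (simp add: Q'_def xdeg_def upoly_add degree_add_le)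
    qed
    ultimately show ?thesis
      using mQ(1) False by (intro exI[of _ "Suc m"] exI[of _ Q']) auto
  qed
qed

text \<open>
  If \<open>x\<^sub>i\<close> is algebraic modulo \<open>P\<close>, its minimal polynomial \<open>f\<close> is an element of \<open>P\<close> of least degree in
  \<open>x\<^sub>i\<close> among those outside \<open>elim i P\<close>. Up to a factor outside \<open>P\<close>, it generates \<open>P\<close> over \<open>elim i P\<close>.
\<close>

lemma minimal_relation:
  fixes P :: "('n::finite, 'k::comm_ring_1) mpoly set"
  assumes P: "is_prime P" and ne: "elim i P \<noteq> P"
  obtains f where "f \<in> P" "f \<notin> elim i P" "0 < xdeg i f" "xlead i f \<notin> P"
    "\<forall>g\<in>P. xdeg i g < xdeg i f \<longrightarrow> g \<in> elim i P"
    "\<forall>g\<in>P. \<exists>m a. xlead i f ^ m * g - a * f \<in> elim i P"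
proof -
  \<comment> \<open>candidates for a minimal polynomial of \<open>x\<^sub>i\<close>\<close>
  define S where "S = P - elim i P"
  have "S \<noteq> {}" using ne elim_subset[OF P] by (auto simp: S_def)
  then obtain f where f: "f \<in> S" and min: "\<And>g. g \<in> S \<Longrightarrow> xdeg i f \<le> xdeg i g"
    using ex_has_least_nat[of "\<lambda>g. g \<in> S" _ "xdeg i"] by blast
  have fP: "f \<in> P" "f \<notin> elim i P" using f by (auto simp: S_def)
  have small: "g \<in> elim i P" if "g \<in> P" "xdeg i g < xdeg i f" for g
    using min[of g] that by (auto simp: S_def)
  have d: "0 < xdeg i f"
    using xdeg_0_free[of i f] elim_free[OF P, of i f] fP by (cases "xdeg i f") auto
  have lead: "xlead i f \<notin> P"
  proof
    assume "xlead i f \<in> P"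
    then have 1: "xlead i f * var i ^ xdeg i f \<in> elim i P"
      using elim_free[OF P free_of_xlead] prime_mult_right[OF is_prime_elim[OF P]] by blast
    then have "f - xlead i f * var i ^ xdeg i f \<in> P"
      using elim_subset[OF P] fP prime_diff[OF P] by blast
    then have "f - xlead i f * var i ^ xdeg i f \<in> elim i P"
      using small xdeg_drop_lead[OF d] by blast
    from prime_add[OF is_prime_elim[OF P] this 1] fP show False by simp
  qed
  have "\<exists>m a. xlead i f ^ m * g - a * f \<in> elim i P" if g: "g \<in> P" for g
  proof -
    obtain m Q where "xdeg i (xlead i f ^ m * g - Q * f) < xdeg i f"
      using pseudo_division[OF d] by blast
    then show ?thesis
      using small[of "xlead i f ^ m * g - Q * f"] g fP
      by (blast intro: prime_diff[OF P] prime_mult_left[OF P])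
  qed
  with that fP small d lead show thesis by blast
qed

section \<open>Transcendence degree and tangent spaces\<close>

text \<open>
  The variables outside \<open>A\<close> are algebraically independent modulo \<open>P\<close>: the coordinate ring of a
  prime of height at most \<open>m\<close> has transcendence degree at least the number of variables minus \<open>m\<close>.
\<close>

lemma prime_contains_no_free:
  fixes P :: "('n::finite, 'k::field) mpoly set"
  assumes "is_prime P"
  shows "\<exists>m. enat m \<le> prime_height ring_of_type_algebra P \<and>
    (\<exists>A. card A \<le> m \<and> (\<forall>g\<in>P. (\<forall>l\<in>A. free_of l g) \<longrightarrow> g = 0))"
  using assms
proof (rule prime_elim_induct)
  show "\<exists>A. card A \<le> 0 \<and> (\<forall>g\<in>{0 :: ('n, 'k) mpoly}. (\<forall>l\<in>A. free_of l g) \<longrightarrow> g = 0)"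
    by (rule exI[of _ "{}"]) simp
next
  fix P :: "('n, 'k) mpoly set" and i m
  assume P: "is_prime P" and "\<exists>A. card A \<le> m \<and> (\<forall>g\<in>elim i P. (\<forall>l\<in>A. free_of l g) \<longrightarrow> g = 0)"
  then obtain A where A: "card A \<le> m" "\<forall>g\<in>elim i P. (\<forall>l\<in>A. free_of l g) \<longrightarrow> g = 0" by blast
  show "\<exists>A. card A \<le> Suc m \<and> (\<forall>g\<in>P. (\<forall>l\<in>A. free_of l g) \<longrightarrow> g = 0)"
  proof (rule exI[of _ "insert i A"], intro conjI ballI impI)
    show "card (insert i A) \<le> Suc m" using A(1) by (simp add: card_insert_if)
    show "g = 0" if "g \<in> P" "\<forall>l\<in>insert i A. free_of l g" for g
      using that A(2) elim_free[OF P, of i g] by auto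
  qed
qed

text \<open>
  Polynomial vector fields that are tangent to the variety of \<open>P\<close> (they map \<open>P\<close> into itself) and, at
  every point where \<open>\<delta>\<close> does not vanish, linearly independent. There is one field for each
  coordinate direction outside \<open>J\<close>, and the fields are normalised so that their components outside
  \<open>J\<close> form \<open>\<delta>\<close> times the identity matrix. So \<open>card J\<close> bounds the codimension of the tangent space.
\<close>

definition tangent_frame :: "('n::finite, 'k::comm_ring_1) mpoly set \<Rightarrow> 'n set \<Rightarrow> bool" where
  "tangent_frame P J \<longleftrightarrow>
     (\<exists>\<delta> u. \<delta> \<notin> P \<and>
       (\<forall>j. j \<notin> J \<longrightarrow>
          (\<forall>l. l \<notin> J \<longrightarrow> u j l = (if l = j then \<delta> else 0)) \<and> (\<forall>g\<in>P. vfield (u j) g \<in> P)))"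

lemma xcoeff_vfield_free:
  assumes "free_of i h"
  shows "xcoeff i n (vfield u h) = vfield (\<lambda>l. xcoeff i n (u l)) h"
proof -
  have "upoly i (u l * partial_deriv l h) = Polynomial.smult (partial_deriv l h) (upoly i (u l))" for l
    using upoly_free[OF free_of_partial_deriv[OF assms, of l]] by (simp add: upoly_mult)
  then have "xcoeff i n (u l * partial_deriv l h) = xcoeff i n (u l) * partial_deriv l h" for l
    by (simp add: xcoeff_def mult.commute)
  then show ?thesis
    by (simp add: vfield_def xcoeff_def upoly_sum coeff_sum)
qed

text \<open>
  A frame for \<open>elim i P\<close> involves a function \<open>\<delta>\<close> outside \<open>elim i P\<close> that may well lie in \<open>P\<close>. Taking
  one coefficient with respect to \<open>x\<^sub>i\<close> of all components repairs this, since \<open>elim i P\<close> is generated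
  by polynomials without \<open>x\<^sub>i\<close>, and for those taking a coefficient commutes with the derivation.
\<close>

lemma tangent_frame_elim:
  fixes P :: "('n::finite, 'k::comm_ring_1) mpoly set"
  assumes P: "is_prime P" and "tangent_frame (elim i P) J"
  obtains \<delta> u where "\<delta> \<notin> P" "\<forall>j l. j \<notin> J \<longrightarrow> l \<notin> J \<longrightarrow> u j l = (if l = j then \<delta> else 0)"
    "\<forall>j g. j \<notin> J \<longrightarrow> g \<in> elim i P \<longrightarrow> vfield (u j) g \<in> P"
proof -
  obtain \<delta> u where d: "\<delta> \<notin> elim i P" "\<forall>j. j \<notin> J \<longrightarrow>
      (\<forall>l. l \<notin> J \<longrightarrow> u j l = (if l = j then \<delta> else 0)) \<and> (\<forall>g\<in>elim i P. vfield (u j) g \<in> elim i P)"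
    using assms(2) unfolding tangent_frame_def by blast
  obtain n where n: "xcoeff i n \<delta> \<notin> P" using d(1) by (auto simp: elim_def)
  define w where "w j l = xcoeff i n (u j l)" for j l
  have free: "vfield (w j) h \<in> P" if "free_of i h" "h \<in> P" "j \<notin> J" for h j
  proof -
    have "vfield (u j) h \<in> elim i P" using that elim_free[OF P] d(2) by blast
    then have "xcoeff i n (vfield (u j) h) \<in> P" by (simp add: elim_def)
    then show ?thesis using that by (simp add: xcoeff_vfield_free w_def[abs_def])
  qed
  have "vfield (w j) g \<in> P" if g: "g \<in> elim i P" and j: "j \<notin> J" for g j
  proof -
    have "vfield (w j) (xcoeff i k g * var i ^ k) \<in> P" for k
      using g free[OF free_of_xcoeff _ j, of k g]
      by (auto simp: vfield_mult elim_def intro!: prime_add[OF P] prime_mult_right[OF P])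
    then have "vfield (w j) (\<Sum>k\<le>Polynomial.degree (upoly i g). xcoeff i k g * var i ^ k) \<in> P"
      by (auto simp: vfield_sum intro!: prime_sum[OF P])
    then show ?thesis by (simp only: flip: mpoly_eq_sum_xcoeff)
  qed
  moreover have "w j l = (if l = j then xcoeff i n \<delta> else 0)" if "j \<notin> J" "l \<notin> J" for j l
    using d(2) that by (simp add: w_def)
  ultimately show thesis using that[of "xcoeff i n \<delta>" w] n by auto
qed

lemma vfield_lincomb: "vfield (\<lambda>l. a * u l - b * w l) g = a * vfield u g - b * vfield w g"
  for a :: "('n::finite, 'k::comm_ring_1) mpoly"
  by (simp add: vfield_def left_diff_distrib sum_subtractf sum_distrib_left mult.assoc)

text \<open>
  Passing from \<open>elim i P\<close> to \<open>P\<close> adds essentially one equation \<open>f\<close>, hence one linear condition on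
  tangent vectors; one step of Gaussian elimination costs at most one direction. Even if
  \<open>f\<close> is inseparable in \<open>x\<^sub>i\<close>, it still amounts to at most one condition.
\<close>

lemma tangent_frame_step:
  fixes P :: "('n::finite, 'k::comm_ring_1) mpoly set"
  assumes P: "is_prime P" and ne: "elim i P \<noteq> P" and "tangent_frame (elim i P) J"
  shows "\<exists>J'. card J' \<le> Suc (card J) \<and> tangent_frame P J'"
proof -
  obtain \<delta> u where d: "\<delta> \<notin> P" "\<forall>j l. j \<notin> J \<longrightarrow> l \<notin> J \<longrightarrow> u j l = (if l = j then \<delta> else 0)"
    "\<forall>j g. j \<notin> J \<longrightarrow> g \<in> elim i P \<longrightarrow> vfield (u j) g \<in> P"
    by (rule tangent_frame_elim[OF P assms(3)])
  obtain f where f: "f \<in> P" "f \<notin> elim i P" "0 < xdeg i f" "xlead i f \<notin> P"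
    and small: "\<forall>g\<in>P. xdeg i g < xdeg i f \<longrightarrow> g \<in> elim i P"
    and rel: "\<forall>g\<in>P. \<exists>m a. xlead i f ^ m * g - a * f \<in> elim i P"
    by (rule minimal_relation[OF P ne])
  have tangent: "vfield w g \<in> P"
    if w: "\<And>h. h \<in> elim i P \<Longrightarrow> vfield w h \<in> P" "vfield w f \<in> P" and g: "g \<in> P" for w g
  proof -
    obtain m a where h: "xlead i f ^ m * g - a * f \<in> elim i P" using rel g by blast
    define s where "s = xlead i f ^ m"
    define h where "h = s * g - a * f"
    have h: "h \<in> elim i P" using h by (simp add: h_def s_def)
    have "s * g = a * f + h" by (simp add: h_def)
    then have "vfield w (s * g) = vfield w (a * f + h)" by (rule arg_cong)
    then have "s * vfield w g = vfield w a * f + a * vfield w f + vfield w h - vfield w s * g"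
      by (simp only: vfield_add vfield_mult) (simp add: algebra_simps)
    also have "\<dots> \<in> P"
      using w(1)[OF h] w(2) g f(1) by (simp add: prime_diff[OF P] prime_add[OF P] prime_mult_left[OF P])
    finally show ?thesis
      using f(4) prime_power[OF P, of "xlead i f" m] by (auto simp: s_def prime_mult_iff[OF P])
  qed
  show ?thesis
  proof (cases "\<forall>j. j \<notin> J \<longrightarrow> vfield (u j) f \<in> P")
    case True
    then have "tangent_frame P J"
      unfolding tangent_frame_def
    proof (intro exI[of _ \<delta>] exI[of _ u] conjI allI impI ballI)
      show "vfield (u j) g \<in> P" if j: "j \<notin> J" and g: "g \<in> P" for j g
        by (rule tangent[OF _ _ g]) (use True d(3) j in simp_all)
    qed (use d(1,2) in simp_all)
    then show ?thesis by (intro exI[of _ J]) auto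
  next
    case False
    then obtain k where k: "k \<notin> J" "vfield (u k) f \<notin> P" by blast
    \<comment> \<open>the combination of \<open>u\<^sub>j\<close> and the pivot \<open>u\<^sub>k\<close> that annihilates \<open>f\<close>\<close>
    define w where "w j l = vfield (u k) f * u j l - vfield (u j) f * u k l" for j l
    have "tangent_frame P (insert k J)"
      unfolding tangent_frame_def
    proof (intro exI[of _ "vfield (u k) f * \<delta>"] exI[of _ w] conjI allI impI ballI)
      show "vfield (u k) f * \<delta> \<notin> P" using k d(1) by (simp add: prime_mult_iff[OF P])
      show "w j l = (if l = j then vfield (u k) f * \<delta> else 0)" if "j \<notin> insert k J" "l \<notin> insert k J" for j l
        using that k d(2) by (simp add: w_def)
      show "vfield (w j) g \<in> P" if j: "j \<notin> insert k J" and g: "g \<in> P" for j g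
      proof (rule tangent[OF _ _ g])
        have w: "w j = (\<lambda>l. vfield (u k) f * u j l - vfield (u j) f * u k l)"
          by (simp add: w_def fun_eq_iff)
        show "vfield (w j) h \<in> P" if "h \<in> elim i P" for h
          unfolding w vfield_lincomb
          using d(3) that k(1) j
          by (simp add: prime_diff[OF P] prime_mult_left[OF P])
        show "vfield (w j) f \<in> P"
          unfolding w vfield_lincomb
          by (subst mult.commute) (simp only: diff_self prime_0[OF P])
      qed
    qed
    then show ?thesis by (intro exI[of _ "insert k J"]) (simp add: card_insert_if)
  qed
qed

lemma ex_tangent_frame:
  fixes P :: "('n::finite, 'k::field) mpoly set"
  assumes "is_prime P"
  shows "\<exists>m. enat m \<le> prime_height ring_of_type_algebra P \<and> (\<exists>J. card J \<le> m \<and> tangent_frame P J)"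
  using assms
proof (rule prime_elim_induct)
  have "tangent_frame {0 :: ('n, 'k) mpoly} {}"
    unfolding tangent_frame_def
    by (rule exI[of _ 1], rule exI[of _ "\<lambda>j l. if l = j then 1 else 0"]) simp
  then show "\<exists>J. card J \<le> 0 \<and> tangent_frame {0 :: ('n, 'k) mpoly} J" by (intro exI[of _ "{}"]) simp
next
  fix P :: "('n, 'k) mpoly set" and i m
  assume "is_prime P" "elim i P \<noteq> P" "\<exists>J. card J \<le> m \<and> tangent_frame (elim i P) J"
  then show "\<exists>J. card J \<le> Suc m \<and> tangent_frame P J"
    using tangent_frame_step[of P i] by (meson Suc_le_mono order_trans)
qed

section \<open>Zeros of prime ideals\<close>

text \<open>
  A function that does not vanish identically on the variety of \<open>P\<close> divides, modulo \<open>P\<close>, a nonzero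
  function of the other variables: the norm along the algebraic element \<open>x\<^sub>i\<close>. Instead of a norm,
  the proof takes an element \<open>t\<close> of least degree in \<open>x\<^sub>i\<close> in the ideal generated by \<open>s\<close> and \<open>P\<close>, but
  outside \<open>P\<close>. If \<open>t\<close> had positive degree, dividing the minimal polynomial \<open>f\<close> by \<open>t\<close> would factor \<open>f\<close>.
\<close>

lemma free_of_relation:
  fixes P :: "('n::finite, 'k::comm_ring_1) mpoly set"
  assumes P: "is_prime P" and ne: "elim i P \<noteq> P" and s: "s \<notin> P"
  shows "\<exists>a p. p \<in> P \<and> a * s + p \<notin> P \<and> free_of i (a * s + p)"
proof -
  obtain f where f: "f \<in> P" "f \<notin> elim i P" "0 < xdeg i f" "xlead i f \<notin> P"
    and small: "\<forall>g\<in>P. xdeg i g < xdeg i f \<longrightarrow> g \<in> elim i P"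
    and rel: "\<forall>g\<in>P. \<exists>m a. xlead i f ^ m * g - a * f \<in> elim i P"
    by (rule minimal_relation[OF P ne])
  define I where "I = {a * s + p | a p. p \<in> P}"
  have I_comb: "x * t + y * p \<in> I" if t: "t \<in> I" and p: "p \<in> P" for x y t p
  proof -
    obtain a q where "t = a * s + q" "q \<in> P" using t by (auto simp: I_def)
    then have "x * t + y * p = x * a * s + (x * q + y * p)" "x * q + y * p \<in> P"
      using p by (simp_all add: algebra_simps prime_add[OF P] prime_mult_left[OF P] prime_mult_right[OF P])
    then show ?thesis unfolding I_def by blast
  qed
  have "s = 1 * s + 0" by simp
  then have "s \<in> I - P" using s prime_0[OF P] unfolding I_def by blast
  then obtain t where t: "t \<in> I" "t \<notin> P" and min: "\<And>g. g \<in> I \<Longrightarrow> g \<notin> P \<Longrightarrow> xdeg i t \<le> xdeg i g"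
    using ex_has_least_nat[of "\<lambda>g. g \<in> I - P" s "xdeg i"] by blast
  have "xdeg i t = 0"
  proof (rule ccontr)
    assume "xdeg i t \<noteq> 0"
    then have pos: "0 < xdeg i t" by simp
    have lead: "xlead i t \<notin> P"
    proof
      assume "xlead i t \<in> P"
      then have L: "xlead i t * var i ^ xdeg i t \<in> P" by (rule prime_mult_right[OF P])
      let ?t = "t - xlead i t * var i ^ xdeg i t"
      have "?t \<in> I" using I_comb[OF t(1) L, of 1 "-1"] by simp
      moreover have "?t \<notin> P" using prime_add[OF P _ L, of ?t] t(2) by auto
      ultimately show False using min[of ?t] xdeg_drop_lead[OF pos] by simp
    qed
    have lt: "xdeg i t < xdeg i f"
    proof (rule ccontr)
      assume le: "\<not> xdeg i t < xdeg i f"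
      let ?m = "xlead i t * var i ^ (xdeg i t - xdeg i f)"
      let ?t = "xlead i f * t - ?m * f"
      have "?t \<in> I" using I_comb[OF t(1) f(1), of "xlead i f" "- ?m"] by simp
      moreover have "?t \<notin> P"
        using prime_add[OF P _ prime_mult_left[OF P f(1)], of ?t ?m] t(2) f(4)
        by (auto simp: prime_mult_iff[OF P])
      ultimately show False using min[of ?t] xdeg_cancel_lead[of i f t] le pos by simp
    qed
    obtain m q where mq: "xdeg i (xlead i t ^ m * f - q * t) < xdeg i t"
      "q = 0 \<or> xdeg i q + xdeg i t \<le> xdeg i f"
      using pseudo_division[OF pos, of f] by blast
    let ?r = "xlead i t ^ m * f - q * t"
    have "?r \<in> I" using I_comb[OF t(1) f(1), of "- q" "xlead i t ^ m"] by simp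
    then have r: "?r \<in> P" using min[of ?r] mq(1) by auto
    then have "?r \<in> elim i P" using small r mq(1) lt by simp
    have "xlead i t ^ m * f - ?r \<in> P" by (rule prime_diff[OF P prime_mult_left[OF P f(1)] r])
    then have "q \<in> P" using t(2) by (simp add: prime_mult_iff[OF P])
    then have "q \<in> elim i P"
      using small mq(2) pos lt prime_0[OF is_prime_elim[OF P]] by auto
    with \<open>?r \<in> elim i P\<close> have "?r + q * t \<in> elim i P"
      by (intro prime_add prime_mult_right is_prime_elim P)
    then have "xlead i t ^ m \<in> elim i P"
      using f(2) by (simp add: prime_mult_iff[OF is_prime_elim[OF P]])
    then show False using lead prime_power[OF P] elim_subset[OF P] by blast
  qed
  then have "free_of i t" by (rule xdeg_0_free)
  with t show ?thesis by (auto simp: I_def)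
qed

lemma eval_diff: "eval v (F - G) = eval v F - eval v (G :: ('n::finite, 'k::comm_ring_1) mpoly)"
  using ev.insertion_add[of v "F - G" G] by (simp add: eq_diff_eq)

lemma eval_free_upd:
  assumes "free_of i F"
  shows "eval (v(i := t)) F = eval v F"
  unfolding ev.insertion_def
proof (intro sum.cong refl arg_cong2[where f = "(*)"] prod.cong)
  fix m j assume "m \<in> Poly_Mapping.keys F"
  then have "Poly_Mapping.lookup m i = 0" using assms by (auto simp: free_of_def in_keys_iff)
  then show "(v(i := t)) j ^ Poly_Mapping.lookup m j = v j ^ Poly_Mapping.lookup m j" by auto
qed

text \<open>
  The univariate polynomial that arises when all variables but the \<open>i\<close>-th are specialised.
\<close>

definition ueval :: "'n::finite \<Rightarrow> ('n \<Rightarrow> 'k::comm_ring_1) \<Rightarrow> ('n, 'k) mpoly \<Rightarrow> 'k poly" where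
  "ueval i v F = (\<Sum>n\<le>xdeg i F. Polynomial.monom (eval v (xcoeff i n F)) n)"

lemma coeff_ueval: "Polynomial.coeff (ueval i v F) n = eval v (xcoeff i n F)"
  by (auto simp: ueval_def coeff_sum xcoeff_beyond)

lemma poly_ueval: "poly (ueval i v F) t = eval (v(i := t)) F"
proof -
  have "eval (v(i := t)) F = eval (v(i := t)) (\<Sum>n\<le>xdeg i F. xcoeff i n F * var i ^ n)"
    by (simp only: xdeg_def flip: mpoly_eq_sum_xcoeff)
  also have "\<dots> = (\<Sum>n\<le>xdeg i F. eval v (xcoeff i n F) * t ^ n)"
    by (simp add: ev.insertion_sum ev.insertion_mult ev.insertion_power eval_free_upd free_of_xcoeff)
  finally show ?thesis by (simp add: ueval_def poly_sum poly_monom)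
qed

lemma infinite_alg_closed: "infinite (UNIV :: 'k::alg_closed_field set)"
proof
  assume fin: "finite (UNIV :: 'k set)"
  define p :: "'k poly" where "p = (\<Prod>a\<in>UNIV. [:- a, 1:])"
  have "Polynomial.degree p = card (UNIV :: 'k set)"
    unfolding p_def by (simp add: degree_prod_sum_eq)
  then have "Polynomial.degree p > 0" using fin by (simp add: card_gt_0_iff)
  then have "Polynomial.degree (p + 1) > 0" by (simp add: degree_add_eq_left)
  then obtain x where "poly (p + 1) x = 0" using alg_closed_imp_poly_has_root by blast
  moreover have "poly p x = 0" using fin by (simp add: p_def poly_prod prod_zero_iff)
  ultimately show False by simp
qed

text \<open>
  Specialise one variable after the other, avoiding the finitely many roots of a coefficient.
\<close>

lemma ex_eval_nonzero:
  fixes F :: "('n::finite, 'k::alg_closed_field) mpoly"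
  assumes "F \<noteq> 0"
  shows "\<exists>v. eval v F \<noteq> 0"
  using assms
proof (induction "card {l. \<not> free_of l F}" arbitrary: F rule: less_induct)
  case less
  show ?case
  proof (cases "\<forall>l. free_of l F")
    case True
    then have F: "F = const (Poly_Mapping.lookup F 0)" by (intro free_of_all) blast
    with less.prems have "Poly_Mapping.lookup F 0 \<noteq> 0" by (metis const_0)
    then show ?thesis by (subst F) simp
  next
    case False
    then obtain l where l: "\<not> free_of l F" by blast
    have "\<exists>n. xcoeff l n F \<noteq> 0"
    proof (rule ccontr)
      assume "\<not> (\<exists>n. xcoeff l n F \<noteq> 0)"
      then have "upoly l F = 0" by (simp add: poly_eq_iff xcoeff_def)
      then have "F = 0" using poly_upoly[of l F] by simp
      with less.prems show False by simp
    qed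
    then obtain n where n: "xcoeff l n F \<noteq> 0" by blast
    have "{j. \<not> free_of j (xcoeff l n F)} \<subset> {j. \<not> free_of j F}"
      using l free_of_xcoeff free_of_xcoeff_other by blast
    then have "card {j. \<not> free_of j (xcoeff l n F)} < card {j. \<not> free_of j F}"
      by (intro psubset_card_mono) auto
    then obtain v where "eval v (xcoeff l n F) \<noteq> 0" using less.hyps n by blast
    then have "ueval l v F \<noteq> 0" using coeff_ueval[of l v F n] by auto
    then have "finite {t. poly (ueval l v F) t = 0}" by (rule poly_roots_finite)
    then obtain t where "poly (ueval l v F) t \<noteq> 0"
      using infinite_alg_closed[where 'k = 'k] by (metis (mono_tags) UNIV_I finite_subset mem_Collect_eq subsetI)
    then show ?thesis by (auto simp: poly_ueval)
  qed
qed

text \<open>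
  Points are lifted through the eliminations. Given a point of \<open>elim i P\<close>, a root of the specialised
  minimal polynomial of \<open>x\<^sub>i\<close> serves as the missing coordinate; the leading coefficient has to be
  nonzero at the point, and the condition on \<open>s\<close> is moved to the other variables by
  \<open>free_of_relation\<close>.
\<close>

lemma nullstellensatz_prime:
  fixes P :: "('n::finite, 'k::alg_closed_field) mpoly set"
  assumes P: "is_prime P" and s: "s \<notin> P"
  obtains v where "\<And>g. g \<in> P \<Longrightarrow> eval v g = 0" "eval v s \<noteq> 0"
proof -
  have "\<exists>m. enat m \<le> prime_height ring_of_type_algebra P \<and>
      (\<forall>s. s \<notin> P \<longrightarrow> (\<exists>v. (\<forall>g\<in>P. eval v g = 0) \<and> eval v s \<noteq> 0))"
    using P
  proof (rule prime_elim_induct)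
    show "\<forall>s. s \<notin> {0 :: ('n, 'k) mpoly} \<longrightarrow> (\<exists>v. (\<forall>g\<in>{0 :: ('n, 'k) mpoly}. eval v g = 0) \<and> eval v s \<noteq> 0)"
      using ex_eval_nonzero by auto
  next
    fix P :: "('n, 'k) mpoly set" and i
    assume P: "is_prime P" and ne: "elim i P \<noteq> P"
      and IH: "\<forall>s. s \<notin> elim i P \<longrightarrow> (\<exists>v. (\<forall>g\<in>elim i P. eval v g = 0) \<and> eval v s \<noteq> 0)"
    obtain f where f: "f \<in> P" "f \<notin> elim i P" "0 < xdeg i f" "xlead i f \<notin> P"
    and small: "\<forall>g\<in>P. xdeg i g < xdeg i f \<longrightarrow> g \<in> elim i P"
    and rel: "\<forall>g\<in>P. \<exists>m a. xlead i f ^ m * g - a * f \<in> elim i P"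
    by (rule minimal_relation[OF P ne])
    show "\<forall>s. s \<notin> P \<longrightarrow> (\<exists>v. (\<forall>g\<in>P. eval v g = 0) \<and> eval v s \<noteq> 0)"
    proof (intro allI impI)
      fix s assume "s \<notin> P"
      then obtain b p where p: "p \<in> P" "b * s + p \<notin> P" "free_of i (b * s + p)"
        using free_of_relation[OF P ne] by blast
      \<comment> \<open>the leading coefficient is included so that the degree of \<open>f\<close> survives specialisation\<close>
      have "(b * s + p) * xlead i f \<notin> elim i P"
        using p(2) f(4) elim_subset[OF P] by (auto simp: prime_mult_iff[OF is_prime_elim[OF P]])
      then obtain v where v: "\<And>g. g \<in> elim i P \<Longrightarrow> eval v g = 0" "eval v ((b * s + p) * xlead i f) \<noteq> 0"
        using IH by blast
      have vs: "eval v (b * s + p) \<noteq> 0" "eval v (xlead i f) \<noteq> 0"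
        using v(2) by (auto simp: ev.insertion_mult)
      have "Polynomial.degree (ueval i v f) \<ge> xdeg i f"
        using vs(2) by (intro le_degree) (simp add: coeff_ueval xlead_def)
      then obtain t where t: "poly (ueval i v f) t = 0"
        using f(3) alg_closed_imp_poly_has_root[of "ueval i v f"] by auto
      let ?v = "v(i := t)"
      have elim0: "eval ?v g = 0" if "g \<in> elim i P" for g
      proof -
        have "g \<in> elim i (elim i P)" using that by (simp only: elim_idem[OF P])
        then have "xcoeff i n g \<in> elim i P" for n by (simp add: elim_def[of i "elim i P"])
        then have "ueval i v g = 0" by (simp add: ueval_def v(1))
        then show ?thesis by (simp flip: poly_ueval)
      qed
      have P0: "eval ?v g = 0" if g: "g \<in> P" for g
      proof -
        obtain m a where "xlead i f ^ m * g - a * f \<in> elim i P" using rel g by blast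
        then have "eval ?v (xlead i f) ^ m * eval ?v g - eval ?v a * eval ?v f = 0"
          using elim0 by (simp flip: ev.insertion_mult ev.insertion_power eval_diff)
        moreover have "eval ?v f = 0" using t by (simp add: poly_ueval)
        ultimately show ?thesis using vs(2) by (simp add: eval_free_upd[OF free_of_xlead])
      qed
      have "eval ?v (b * s + p) \<noteq> 0" using vs(1) p(3) by (simp add: eval_free_upd)
      then have "eval ?v s \<noteq> 0" using P0[OF p(1)] by (auto simp: ev.insertion_add ev.insertion_mult)
      with P0 show "\<exists>v. (\<forall>g\<in>P. eval v g = 0) \<and> eval v s \<noteq> 0" by blast
    qed
  qed
  with s that show thesis by blast
qed

section \<open>Linear algebra\<close>

text \<open>
  A homogeneous linear system with fewer equations (indexed by \<open>V\<close>) than unknowns (indexed by \<open>U\<close>)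
  has a nontrivial solution: eliminate one unknown by means of one equation.
\<close>

lemma homogeneous_system_nontrivial:
  fixes c :: "'a \<Rightarrow> 'b \<Rightarrow> 'k::field"
  assumes "finite V" "finite U" "card V < card U"
  shows "\<exists>x. (\<exists>a\<in>U. x a \<noteq> 0) \<and> (\<forall>b\<in>V. (\<Sum>a\<in>U. x a * c a b) = 0)"
  using assms
proof (induction V arbitrary: U c rule: finite_induct)
  case empty
  then have "U \<noteq> {}" by auto
  then show ?case by (intro exI[of _ "\<lambda>_. 1"]) auto
next
  case (insert b V)
  show ?case
  proof (cases "\<forall>a\<in>U. c a b = 0")
    case True
    obtain x where "\<exists>a\<in>U. x a \<noteq> 0" "\<forall>b\<in>V. (\<Sum>a\<in>U. x a * c a b) = 0"
      using insert.IH[of U c] insert.prems insert.hyps by auto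
    with True show ?thesis by (intro exI[of _ x]) auto
  next
    case False
    then obtain a0 where a0: "a0 \<in> U" "c a0 b \<noteq> 0" by blast
    let ?U = "U - {a0}"
    have "card V < card ?U" using insert a0 by auto
    then obtain x where x: "\<exists>a\<in>?U. x a \<noteq> 0"
      "\<forall>d\<in>V. (\<Sum>a\<in>?U. x a * (c a d - c a b / c a0 b * c a0 d)) = 0"
      using insert.IH[of ?U "\<lambda>a d. c a d - c a b / c a0 b * c a0 d"] insert.prems by auto
    define s where "s = (\<Sum>a\<in>?U. x a * c a b)"
    define y where "y = x(a0 := - s / c a0 b)"
    have split: "(\<Sum>a\<in>U. y a * c a d) = - s / c a0 b * c a0 d + (\<Sum>a\<in>?U. x a * c a d)" for d
    proof -
      have "(\<Sum>a\<in>U. y a * c a d) = y a0 * c a0 d + (\<Sum>a\<in>?U. y a * c a d)"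
        using insert.prems a0 by (simp add: sum.remove)
      also have "(\<Sum>a\<in>?U. y a * c a d) = (\<Sum>a\<in>?U. x a * c a d)"
        by (intro sum.cong) (auto simp: y_def)
      finally show ?thesis by (simp add: y_def)
    qed
    have "(\<Sum>a\<in>U. y a * c a d) = 0" if "d \<in> insert b V" for d
    proof (cases "d = b")
      case True
      then show ?thesis using a0 by (simp add: split s_def)
    next
      case False
      then have "(\<Sum>a\<in>?U. x a * (c a d - c a b / c a0 b * c a0 d)) = 0" using that x(2) by auto
      then have "(\<Sum>a\<in>?U. x a * c a d) = (\<Sum>a\<in>?U. x a * c a b * (c a0 d / c a0 b))"
        by (simp add: right_diff_distrib sum_subtractf mult_ac sum_divide_distrib sum_distrib_left)
      also have "\<dots> = s * (c a0 d / c a0 b)" by (simp only: s_def sum_distrib_right)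
      finally show ?thesis by (simp add: split)
    qed
    moreover have "\<exists>a\<in>U. y a \<noteq> 0" using x(1) by (auto simp: y_def)
    ultimately show ?thesis by blast
  qed
qed

section \<open>Counting monomials modulo square relations\<close>

definition kspan :: "('n::finite \<Rightarrow> ('n, 'k::comm_ring_1) mpoly) \<Rightarrow> ('n, 'k) mpoly set" where
  "kspan L = {\<Sum>a\<in>UNIV. const (c a) * L a | c. True}"

lemma kspanI: "(\<Sum>a\<in>UNIV. const (c a) * L a) \<in> kspan L"
  by (auto simp: kspan_def)

lemma kspan_add:
  assumes "x \<in> kspan L" "y \<in> kspan L"
  shows "x + y \<in> kspan L"
proof -
  obtain c d where "x = (\<Sum>a\<in>UNIV. const (c a) * L a)" "y = (\<Sum>a\<in>UNIV. const (d a) * L a)"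
    using assms by (auto simp: kspan_def)
  then show ?thesis
    using kspanI[of "\<lambda>a. c a + d a" L] by (simp add: const_add distrib_right sum.distrib)
qed

lemma kspan_scale:
  assumes "x \<in> kspan L"
  shows "const t * x \<in> kspan L"
proof -
  obtain c where "x = (\<Sum>a\<in>UNIV. const (c a) * L a)" using assms by (auto simp: kspan_def)
  then show ?thesis
    using kspanI[of "\<lambda>a. t * c a" L] by (simp add: const_mult sum_distrib_left mult.assoc)
qed

lemma kspan_base: "L a \<in> kspan L"
proof -
  have "L a = (\<Sum>b\<in>UNIV. if b = a then L b else 0)" by simp
  also have "\<dots> = (\<Sum>b\<in>UNIV. const (if b = a then 1 else 0) * L b)" by (intro sum.cong) auto
  finally show ?thesis using kspanI[of "\<lambda>b. if b = a then 1 else 0" L] by simp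
qed

lemma kspan_0: "0 \<in> kspan L"
  using kspan_scale[OF kspan_base, of 0 L] by simp

lemma kspan_sum: "(\<And>x. x \<in> V \<Longrightarrow> g x \<in> kspan L) \<Longrightarrow> sum g V \<in> kspan L"
  by (induction V rule: infinite_finite_induct) (simp_all add: kspan_0 kspan_add)

lemma kspan_diff: "x \<in> kspan L \<Longrightarrow> y \<in> kspan L \<Longrightarrow> x - y \<in> kspan L"
  using kspan_add[OF _ kspan_scale[of y L "-1"], of x] by (simp add: const_uminus)

text \<open>
  Linear coordinates \<open>L\<close> in which, modulo \<open>P\<close>, the square of each \<open>L\<^sub>p\<close> with \<open>p \<in> S\<close> lies in the ideal
  generated by the coordinates outside \<open>S\<close>. Then the ring modulo \<open>P\<close> is finite over the polynomial
  ring in the coordinates outside \<open>S\<close>, so that its dimension is at most the number of variables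
  minus \<open>card S\<close>.
\<close>

locale square_relations =
  fixes P :: "('n::finite, 'k::field) mpoly set"
    and L :: "'n \<Rightarrow> ('n, 'k) mpoly" and S :: "'n set"
  assumes P: "is_prime P"
    and var_span: "var a \<in> kspan L"
    and square: "p \<in> S \<Longrightarrow> \<exists>h. (\<forall>b. h b \<in> kspan L) \<and> L p ^ 2 - (\<Sum>b\<in>-S. L b * h b) \<in> P"
begin

definition Lmon :: "('n \<Rightarrow> nat) \<Rightarrow> ('n, 'k) mpoly" where
  "Lmon \<alpha> = (\<Prod>a\<in>UNIV. L a ^ \<alpha> a)"

definition admissible :: "nat \<Rightarrow> ('n \<Rightarrow> nat) set" where
  "admissible n = {\<alpha>. (\<Sum>a\<in>UNIV. \<alpha> a) = n \<and> (\<forall>p\<in>S. \<alpha> p \<le> 1)}"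

text \<open>
  Everything that is, modulo \<open>P\<close>, a linear combination of monomials of degree \<open>n\<close> in the
  coordinates \<open>L\<close> that are squarefree in the coordinates from \<open>S\<close>.
\<close>

definition spanned :: "nat \<Rightarrow> ('n, 'k) mpoly set" where
  "spanned n = {g. \<exists>c. g - (\<Sum>\<alpha>\<in>admissible n. const (c \<alpha>) * Lmon \<alpha>) \<in> P}"

lemma admissible_bound: "\<alpha> \<in> admissible n \<Longrightarrow> \<alpha> a \<le> n"
  unfolding admissible_def by (auto intro: member_le_sum)

lemma finite_admissible: "finite (admissible n)"
proof (rule finite_subset)
  show "admissible n \<subseteq> (\<Pi>\<^sub>E a\<in>UNIV. {..n})" using admissible_bound by (auto simp: PiE_def extensional_def)
qed (intro finite_PiE, auto)

lemma spanned_P: "g \<in> P \<Longrightarrow> g \<in> spanned n"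
  by (auto simp: spanned_def intro!: exI[of _ "\<lambda>_. 0"])

lemma spanned_Lmon: "\<alpha> \<in> admissible n \<Longrightarrow> Lmon \<alpha> \<in> spanned n"
proof -
  assume a: "\<alpha> \<in> admissible n"
  have "(\<Sum>\<beta>\<in>admissible n. const (if \<beta> = \<alpha> then 1 else 0) * Lmon \<beta>) = (\<Sum>\<beta>\<in>admissible n. if \<beta> = \<alpha> then Lmon \<beta> else 0)"
    by (intro sum.cong) auto
  also have "\<dots> = Lmon \<alpha>" using a finite_admissible by simp
  finally have "Lmon \<alpha> - (\<Sum>\<beta>\<in>admissible n. const (if \<beta> = \<alpha> then 1 else 0) * Lmon \<beta>) \<in> P"
    using prime_0[OF P] by simp
  then show ?thesis unfolding spanned_def by (intro CollectI exI[of _ "\<lambda>\<beta>. if \<beta> = \<alpha> then 1 else 0"])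
qed

lemma spanned_add: "g \<in> spanned n \<Longrightarrow> h \<in> spanned n \<Longrightarrow> g + h \<in> spanned n"
proof -
  assume "g \<in> spanned n" "h \<in> spanned n"
  then obtain c d where "g - (\<Sum>\<alpha>\<in>admissible n. const (c \<alpha>) * Lmon \<alpha>) \<in> P"
    "h - (\<Sum>\<alpha>\<in>admissible n. const (d \<alpha>) * Lmon \<alpha>) \<in> P" by (auto simp: spanned_def)
  from prime_add[OF P this] have "g + h - (\<Sum>\<alpha>\<in>admissible n. const (c \<alpha> + d \<alpha>) * Lmon \<alpha>) \<in> P"
    by (simp add: const_add distrib_right sum.distrib algebra_simps)
  then show ?thesis unfolding spanned_def by (intro CollectI exI[of _ "\<lambda>\<alpha>. c \<alpha> + d \<alpha>"])
qed

lemma spanned_const: "g \<in> spanned n \<Longrightarrow> const r * g \<in> spanned n"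
proof -
  assume "g \<in> spanned n"
  then obtain c where "g - (\<Sum>\<alpha>\<in>admissible n. const (c \<alpha>) * Lmon \<alpha>) \<in> P" by (auto simp: spanned_def)
  from prime_mult_left[OF P this, of "const r"]
  have "const r * g - (\<Sum>\<alpha>\<in>admissible n. const (r * c \<alpha>) * Lmon \<alpha>) \<in> P"
    by (simp add: const_mult right_diff_distrib sum_distrib_left mult.assoc)
  then show ?thesis unfolding spanned_def by (intro CollectI exI[of _ "\<lambda>\<alpha>. r * c \<alpha>"])
qed

lemma spanned_sum: "(\<And>x. x \<in> V \<Longrightarrow> f x \<in> spanned n) \<Longrightarrow> sum f V \<in> spanned n"
  by (induction V rule: infinite_finite_induct) (auto intro: spanned_add spanned_P prime_0[OF P])

lemma spanned_linear:
  assumes g: "g \<in> spanned n" and gen: "\<And>\<alpha>. \<alpha> \<in> admissible n \<Longrightarrow> t * Lmon \<alpha> \<in> spanned m"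
  shows "t * g \<in> spanned m"
proof -
  obtain c where c: "g - (\<Sum>\<alpha>\<in>admissible n. const (c \<alpha>) * Lmon \<alpha>) \<in> P" using g by (auto simp: spanned_def)
  have "t * g = t * (g - (\<Sum>\<alpha>\<in>admissible n. const (c \<alpha>) * Lmon \<alpha>)) + (\<Sum>\<alpha>\<in>admissible n. const (c \<alpha>) * (t * Lmon \<alpha>))"
    by (simp add: right_diff_distrib sum_distrib_left mult.left_commute)
  also have "\<dots> \<in> spanned m"
  proof (rule spanned_add)
    show "(\<Sum>\<alpha>\<in>admissible n. const (c \<alpha>) * (t * Lmon \<alpha>)) \<in> spanned m" using gen by (intro spanned_sum spanned_const)
  qed (intro spanned_P prime_mult_left[OF P] c)
  finally show ?thesis .
qed

lemma Lmon_upd: "Lmon (\<alpha>(a := \<alpha> a + k)) = L a ^ k * Lmon \<alpha>"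
proof -
  have split: "Lmon \<beta> = L a ^ \<beta> a * (\<Prod>b\<in>UNIV - {a}. L b ^ \<beta> b)" for \<beta>
    unfolding Lmon_def by (simp add: prod.remove[of UNIV a])
  have "(\<Prod>b\<in>UNIV - {a}. L b ^ (\<alpha>(a := \<alpha> a + k)) b) = (\<Prod>b\<in>UNIV - {a}. L b ^ \<alpha> b)"
    by (intro prod.cong) auto
  then show ?thesis by (simp add: split[of "\<alpha>(a := \<alpha> a + k)"] split[of \<alpha>] power_add)
qed

lemma sum_upd: "(\<Sum>b\<in>UNIV. (\<alpha>(a := k)) b) + \<alpha> a = (\<Sum>b\<in>UNIV. \<alpha> b) + (k :: nat)" for a :: 'n
proof -
  have split: "(\<Sum>b\<in>UNIV. \<beta> b) = \<beta> a + (\<Sum>b\<in>UNIV - {a}. \<beta> b)" for \<beta> :: "'n \<Rightarrow> nat"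
    by (simp add: sum.remove[of UNIV a])
  have "(\<Sum>b\<in>UNIV - {a}. (\<alpha>(a := k)) b) = (\<Sum>b\<in>UNIV - {a}. \<alpha> b)"
    by (intro sum.cong) auto
  then show ?thesis using split[of "\<alpha>(a := k)"] split[of \<alpha>] by (simp del: fun_upd_apply add: fun_upd_same)
qed

lemma L_Lmon_in_spanned:
  assumes "\<alpha> \<in> admissible n" "a \<in> S \<Longrightarrow> \<alpha> a = 0"
  shows "L a * Lmon \<alpha> \<in> spanned (Suc n)"
proof -
  have "\<alpha>(a := \<alpha> a + 1) \<in> admissible (Suc n)"
    using assms sum_upd[of \<alpha> a "\<alpha> a + 1"] by (auto simp: admissible_def)
  from spanned_Lmon[OF this] show ?thesis using Lmon_upd[of \<alpha> a 1] by simp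
qed

lemma spanned_kspan:
  assumes "x \<in> kspan L" "\<And>d. L d * g \<in> spanned m"
  shows "x * g \<in> spanned m"
proof -
  obtain c where "x = (\<Sum>b\<in>UNIV. const (c b) * L b)" using assms(1) by (auto simp: kspan_def)
  then have "x * g = (\<Sum>b\<in>UNIV. const (c b) * (L b * g))" by (simp add: sum_distrib_right mult.assoc)
  then show ?thesis using assms(2) by (simp add: spanned_sum spanned_const)
qed

text \<open>
  The rewriting step. If multiplication by \<open>L\<^sub>a\<close> creates a square with \<open>a \<in> S\<close>, the relation replaces
  it by products \<open>L\<^sub>b h\<close> with \<open>b \<notin> S\<close> and \<open>h\<close> linear. The factor \<open>h\<close> is absorbed by the induction
  hypothesis in degree \<open>n - 1\<close>, and the factor \<open>L\<^sub>b\<close> creates no new square.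
\<close>

lemma L_spanned: "g \<in> spanned n \<Longrightarrow> L a * g \<in> spanned (Suc n)"
proof (induction n arbitrary: a g rule: less_induct)
  case (less n)
  show ?case
  proof (rule spanned_linear[OF less.prems])
    fix \<alpha> assume \<alpha>: "\<alpha> \<in> admissible n"
    show "L a * Lmon \<alpha> \<in> spanned (Suc n)"
    proof (cases "a \<in> S \<and> \<alpha> a \<noteq> 0")
      case False
      with \<alpha> show ?thesis by (intro L_Lmon_in_spanned) auto
    next
      case True
      then have a1: "a \<in> S" "\<alpha> a = 1" using \<alpha> by (force simp: admissible_def)+
      define \<beta> where "\<beta> = \<alpha>(a := 0)"
      have \<alpha>\<beta>: "\<alpha> = \<beta>(a := \<beta> a + 1)" using a1 by (auto simp: \<beta>_def)
      have n: "0 < n" and \<beta>: "\<beta> \<in> admissible (n - 1)"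
        using \<alpha> a1 sum_upd[of \<alpha> a 0] by (auto simp: admissible_def \<beta>_def)
      obtain h where h: "\<forall>b. h b \<in> kspan L" and c: "L a ^ 2 - (\<Sum>b\<in>-S. L b * h b) \<in> P"
        using square[OF a1(1)] by blast
      have "L d * Lmon \<beta> \<in> spanned n" for d
        using less.IH[of "n - 1" "Lmon \<beta>" d] spanned_Lmon[OF \<beta>] n by simp
      then have inner: "h b * Lmon \<beta> \<in> spanned n" for b
        by (rule spanned_kspan[OF h[rule_format]])
      have "L a * Lmon \<alpha> = L a ^ 2 * Lmon \<beta>"
        by (subst \<alpha>\<beta>) (simp only: Lmon_upd power2_eq_square power_one_right mult.assoc)
      also have "\<dots> = (L a ^ 2 - (\<Sum>b\<in>-S. L b * h b)) * Lmon \<beta> + (\<Sum>b\<in>-S. L b * (h b * Lmon \<beta>))"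
        by (simp add: left_diff_distrib sum_distrib_right mult.assoc)
      also have "\<dots> \<in> spanned (Suc n)"
      proof (rule spanned_add[OF spanned_P[OF prime_mult_right[OF P c]]], rule spanned_sum)
        fix b assume b: "b \<in> - S"
        show "L b * (h b * Lmon \<beta>) \<in> spanned (Suc n)"
          by (rule spanned_linear[OF inner]) (use b in \<open>auto intro: L_Lmon_in_spanned\<close>)
      qed
      finally show ?thesis .
    qed
  qed
qed

lemma var_spanned: "g \<in> spanned n \<Longrightarrow> var a * g \<in> spanned (Suc n)"
  by (rule spanned_kspan[OF var_span L_spanned])

lemma monomial_spanned: "(\<Prod>a\<in>UNIV. var a ^ \<beta> a) \<in> spanned (\<Sum>a\<in>UNIV. \<beta> a)"
proof -
  have pow: "var a ^ k * g \<in> spanned (n + k)" if "g \<in> spanned n" for a k g n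
    using that by (induction k) (simp_all add: var_spanned mult.assoc)
  have "(\<Prod>a\<in>V. var a ^ \<beta> a) \<in> spanned (\<Sum>a\<in>V. \<beta> a)" if "finite V" for V
    using that
  proof (induction V)
    case empty
    have "(\<lambda>_. 0) \<in> admissible 0" by (simp add: admissible_def)
    from spanned_Lmon[OF this] show ?case by (simp add: Lmon_def)
  next
    case (insert a V)
    then show ?case using pow[of "\<Prod>a\<in>V. var a ^ \<beta> a" "sum \<beta> V" a "\<beta> a"] by (simp add: add.commute)
  qed
  then show ?thesis by simp
qed

text \<open>
  Count monomials with exponents at most \<open>n\<close> in the variables outside \<open>A\<close>: there are
  \<open>(n + 1) ^ card (- A)\<close> of them and they are linearly independent modulo \<open>P\<close>. They are spanned by
  admissible monomials in \<open>L\<close>, whose number grows only like \<open>n ^ card (- S)\<close>. For large \<open>n\<close> this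
  forces \<open>card S \<le> card A\<close>.
\<close>

lemma card_squares_le:
  assumes A: "\<forall>g\<in>P. (\<forall>l\<in>A. free_of l g) \<longrightarrow> g = 0"
  shows "card S \<le> card A"
proof (rule ccontr)
  assume less: "\<not> card S \<le> card A"
  define N where "N = card (UNIV :: 'n set)"
  define q where "q = card S"
  \<comment> \<open>large enough for \<open>2 ^ q * (N * (n + 1)) ^ (N - q) < (n + 1) ^ (N - q + 1)\<close>\<close>
  define n where "n = 2 ^ q * N ^ (N - q)"
  have N: "N \<ge> 1" unfolding N_def by (simp add: Suc_le_eq card_gt_0_iff)
  have qN: "q \<le> N" unfolding q_def N_def by (rule card_mono) auto
  define Mset where "Mset = (\<Pi>\<^sub>E a\<in>UNIV. if a \<in> A then {0} else {..n})"
  define G where "G = (\<Pi>\<^sub>E a\<in>UNIV. if a \<in> S then {..1} else {..N * n})"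
  have fin: "finite Mset" "finite G"
    unfolding Mset_def G_def by (intro finite_PiE; auto)+
  have cardM: "card Mset = (n + 1) ^ card (- A)"
  proof -
    have "card Mset = (\<Prod>a\<in>UNIV. if a \<in> A then 1 else n + 1)"
      unfolding Mset_def by (subst card_PiE) (auto intro!: prod.cong)
    also have "\<dots> = (n + 1) ^ card (- A)"
      by (subst prod.If_cases) (simp_all add: Compl_eq_Diff_UNIV)
    finally show ?thesis .
  qed
  have cardG: "card G = 2 ^ q * (N * n + 1) ^ (N - q)"
  proof -
    have "card G = (\<Prod>a\<in>UNIV. if a \<in> S then 2 else N * n + 1)"
      unfolding G_def by (subst card_PiE) (auto intro!: prod.cong simp: numeral_2_eq_2)
    also have "\<dots> = 2 ^ q * (N * n + 1) ^ card (- S)"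
      by (subst prod.If_cases) (simp_all add: q_def)
    also have "card (- S) = N - q" by (simp add: Compl_eq_Diff_UNIV card_Diff_subset N_def q_def)
    finally show ?thesis .
  qed
  have cardA: "N - q + 1 \<le> card (- A)"
    using less qN by (simp add: Compl_eq_Diff_UNIV card_Diff_subset N_def q_def)
  have "card G < card Mset"
  proof -
    have "card G \<le> 2 ^ q * (N * (n + 1)) ^ (N - q)"
      unfolding cardG using N by (intro mult_left_mono power_mono) auto
    also have "\<dots> = n * (n + 1) ^ (N - q)" by (simp only: n_def power_mult_distrib mult.assoc)
    also have "\<dots> < (n + 1) ^ (N - q + 1)" by simp
    also have "\<dots> \<le> card Mset" unfolding cardM using cardA by (intro power_increasing) auto
    finally show ?thesis .
  qed
  have "\<exists>c. (\<Prod>a\<in>UNIV. var a ^ \<beta> a) - (\<Sum>\<alpha>\<in>G. const (c \<alpha>) * Lmon \<alpha>) \<in> P" if \<beta>: "\<beta> \<in> Mset" for \<beta>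
  proof -
    define d where "d = (\<Sum>a\<in>UNIV. \<beta> a)"
    have "\<beta> a \<le> n" for a
    proof -
      have "\<beta> a \<in> (if a \<in> A then {0} else {..n})" using \<beta> unfolding Mset_def by (rule PiE_mem) simp
      then show ?thesis by (auto split: if_splits)
    qed
    then have dn: "d \<le> N * n" unfolding d_def N_def using sum_bounded_above[of UNIV \<beta> n] by simp
    have sub: "admissible d \<subseteq> G"
    proof
      fix \<alpha> assume a: "\<alpha> \<in> admissible d"
      then have "\<alpha> b \<le> N * n" for b using admissible_bound[of \<alpha> d b] dn by simp
      with a show "\<alpha> \<in> G" by (auto simp: G_def PiE_def extensional_def admissible_def)
    qed
    obtain c where c: "(\<Prod>a\<in>UNIV. var a ^ \<beta> a) - (\<Sum>\<alpha>\<in>admissible d. const (c \<alpha>) * Lmon \<alpha>) \<in> P"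
      using monomial_spanned[of \<beta>] by (auto simp: spanned_def d_def)
    have "(\<Sum>\<alpha>\<in>G. const (if \<alpha> \<in> admissible d then c \<alpha> else 0) * Lmon \<alpha>) = (\<Sum>\<alpha>\<in>admissible d. const (c \<alpha>) * Lmon \<alpha>)"
      using sub fin by (intro sum.mono_neutral_cong_right) auto
    with c show ?thesis by (intro exI[of _ "\<lambda>\<alpha>. if \<alpha> \<in> admissible d then c \<alpha> else 0"]) simp
  qed
  then have "\<forall>\<beta>\<in>Mset. \<exists>c. (\<Prod>a\<in>UNIV. var a ^ \<beta> a) - (\<Sum>\<alpha>\<in>G. const (c \<alpha>) * Lmon \<alpha>) \<in> P" by blast
  from bchoice[OF this] obtain c where
    c: "\<forall>\<beta>\<in>Mset. (\<Prod>a\<in>UNIV. var a ^ \<beta> a) - (\<Sum>\<alpha>\<in>G. const (c \<beta> \<alpha>) * Lmon \<alpha>) \<in> P" by blast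
  obtain x where x: "\<exists>\<beta>\<in>Mset. x \<beta> \<noteq> 0" "\<forall>\<alpha>\<in>G. (\<Sum>\<beta>\<in>Mset. x \<beta> * c \<beta> \<alpha>) = 0"
    using homogeneous_system_nontrivial[OF fin(2,1) \<open>card G < card Mset\<close>] by blast
  define F where "F = (\<Sum>\<beta>\<in>Mset. const (x \<beta>) * (\<Prod>a\<in>UNIV. var a ^ \<beta> a))"
  have "F = (\<Sum>\<beta>\<in>Mset. const (x \<beta>) * ((\<Prod>a\<in>UNIV. var a ^ \<beta> a) - (\<Sum>\<alpha>\<in>G. const (c \<beta> \<alpha>) * Lmon \<alpha>)))"
  proof -
    have "(\<Sum>\<beta>\<in>Mset. const (x \<beta>) * (\<Sum>\<alpha>\<in>G. const (c \<beta> \<alpha>) * Lmon \<alpha>)) =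
        (\<Sum>\<beta>\<in>Mset. \<Sum>\<alpha>\<in>G. const (x \<beta> * c \<beta> \<alpha>) * Lmon \<alpha>)"
      by (simp add: sum_distrib_left const_mult mult.assoc)
    also have "\<dots> = (\<Sum>\<alpha>\<in>G. const (\<Sum>\<beta>\<in>Mset. x \<beta> * c \<beta> \<alpha>) * Lmon \<alpha>)"
      by (subst sum.swap) (simp add: const_sum sum_distrib_right)
    also have "\<dots> = 0" using x(2) by simp
    finally show ?thesis by (simp add: F_def right_diff_distrib sum_subtractf)
  qed
  also have "\<dots> \<in> P" using c by (intro prime_sum[OF P] prime_mult_left[OF P]) blast
  finally have "F \<in> P" .
  have mon: "const r * (\<Prod>a\<in>UNIV. var a ^ \<beta> a) = Poly_Mapping.single (Abs_poly_mapping \<beta>) r" for r :: 'k and \<beta> :: "'n \<Rightarrow> nat"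
    by (simp add: single_eq_prod_var)
  have "free_of l F" if l: "l \<in> A" for l
    unfolding F_def
  proof (rule free_of_sum)
    fix \<beta> assume "\<beta> \<in> Mset"
    then have "\<beta> l \<in> (if l \<in> A then {0} else {..n})" unfolding Mset_def by (rule PiE_mem) simp
    then have "\<beta> l \<in> {0}" using l by simp
    then show "free_of l (const (x \<beta>) * (\<Prod>a\<in>UNIV. var a ^ \<beta> a))"
      unfolding mon by (auto simp: free_of_def lookup_single when_def)
  qed
  with A \<open>F \<in> P\<close> have "F = 0" by blast
  obtain \<beta> where \<beta>: "\<beta> \<in> Mset" "x \<beta> \<noteq> 0" using x(1) by blast
  have inj: "Abs_poly_mapping \<gamma> = Abs_poly_mapping \<beta> \<longleftrightarrow> \<gamma> = \<beta>" for \<gamma> :: "'n \<Rightarrow> nat"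
    by (metis finite lookup_Abs_poly_mapping)
  have "Poly_Mapping.lookup F (Abs_poly_mapping \<beta>) = (\<Sum>\<gamma>\<in>Mset. if \<gamma> = \<beta> then x \<gamma> else 0)"
    unfolding F_def mon lookup_sum lookup_single by (simp add: inj when_def)
  also have "\<dots> = x \<beta>" using \<beta>(1) fin by simp
  finally show False using \<open>F = 0\<close> \<beta>(2) by simp
qed

end

text \<open>
  The reduced row echelon form, without reference to a generating set: \<open>S\<close> is the set of pivot
  columns. It is obtained as a largest set of coordinates on which dual vectors exist in \<open>W\<close>.
\<close>

lemma ex_reduced_basis:
  fixes W :: "('n::finite \<Rightarrow> 'k::field) set"
  assumes add: "\<And>v w. v \<in> W \<Longrightarrow> w \<in> W \<Longrightarrow> (\<lambda>i. v i + w i) \<in> W"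
    and scale: "\<And>a w. w \<in> W \<Longrightarrow> (\<lambda>i. a * w i) \<in> W"
  obtains S r where "\<forall>p\<in>S. r p \<in> W"
    "\<forall>p\<in>S. \<forall>p'\<in>S. r p p' = (if p' = p then 1 else 0)"
    "\<forall>w\<in>W. \<forall>i. w i = (\<Sum>p\<in>S. w p * r p i)"
proof -
  define good where "good S r \<longleftrightarrow> (\<forall>p\<in>S. r p \<in> W \<and> (\<forall>p'\<in>S. r p p' = (if p' = p then 1 else 0)))"
    for S :: "'n set" and r
  have "good {} r" for r by (simp add: good_def)
  then have ex: "\<exists>r. good {} r" by blast
  have bound: "\<forall>T. (\<exists>r. good T r) \<longrightarrow> card T < Suc (card (UNIV :: 'n set))"
    by (simp add: card_mono le_imp_less_Suc)
  obtain S where S: "\<exists>r. good S r" and max: "\<forall>T. (\<exists>r. good T r) \<longrightarrow> card T \<le> card S"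
    using ex_has_greatest_nat[of "\<lambda>S. \<exists>r. good S r" "{}" card, OF ex bound] by blast
  obtain r where r: "good S r" using S by blast
  have rW: "r p \<in> W" if "p \<in> S" for p using r that by (simp add: good_def)
  have rd: "r p p' = (if p' = p then 1 else 0)" if "p \<in> S" "p' \<in> S" for p p' using r that by (simp add: good_def)
  have lin: "(\<lambda>i. w i - (\<Sum>p\<in>T. c p * r p i)) \<in> W" if "w \<in> W" "finite T" "T \<subseteq> S" for w T c
    using that(2,3)
  proof (induction T)
    case (insert p T)
    then have "(\<lambda>i. (w i - (\<Sum>p\<in>T. c p * r p i)) + (- c p) * r p i) \<in> W"
      by (intro add scale rW) auto
    moreover have "(w i - (\<Sum>p\<in>T. c p * r p i)) + (- c p) * r p i = w i - (\<Sum>p\<in>insert p T. c p * r p i)" for i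
      using insert by (simp add: algebra_simps)
    ultimately show ?case by (simp only:)
  qed (simp add: that)
  have "w i = (\<Sum>p\<in>S. w p * r p i)" if w: "w \<in> W" for w i
  proof (rule ccontr)
    assume neq: "w i \<noteq> (\<Sum>p\<in>S. w p * r p i)"
    define v where "v = (\<lambda>j. w j - (\<Sum>p\<in>S. w p * r p j))"
    have v: "v \<in> W" unfolding v_def using w by (intro lin) auto
    have vi: "v i \<noteq> 0" using neq by (simp add: v_def)
    have vS: "v p = 0" if "p \<in> S" for p
    proof -
      have "(\<Sum>p'\<in>S. w p' * r p' p) = (\<Sum>p'\<in>S. if p' = p then w p' else 0)"
        using rd that by (intro sum.cong) auto
      then show ?thesis using that by (simp add: v_def)
    qed
    have iS: "i \<notin> S" using vi vS by blast
    define u where "u = (\<lambda>j. inverse (v i) * v j)"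
    have u: "u \<in> W" unfolding u_def by (rule scale[OF v])
    define r' where "r' p = (if p = i then u else (\<lambda>j. r p j + (- r p i) * u j))" for p
    have "r' p \<in> W" if "p \<in> insert i S" for p
      using that by (auto simp: r'_def u intro!: add scale[OF u] rW simp del: mult_minus_left)
    moreover have "r' p p' = (if p' = p then 1 else 0)" if "p \<in> insert i S" "p' \<in> insert i S" for p p'
      using that vi vS rd iS by (auto simp: r'_def u_def)
    ultimately have "good (insert i S) r'" by (simp add: good_def)
    then have "card (insert i S) \<le> card S" using max by blast
    with iS show False by simp
  qed
  then have "\<forall>w\<in>W. \<forall>i. w i = (\<Sum>p\<in>S. w p * r p i)" by (intro ballI allI)
  moreover have "\<forall>p\<in>S. r p \<in> W" "\<forall>p\<in>S. \<forall>p'\<in>S. r p p' = (if p' = p then 1 else 0)"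
    using r by (simp_all add: good_def)
  ultimately show thesis by (intro that)
qed

section \<open>Forms and linear substitutions\<close>

lemma is_form_iff: "is_form d F \<longleftrightarrow> (\<forall>m. Poly_Mapping.lookup F m \<noteq> 0 \<longrightarrow> mon_degree m = d)"
  by (auto simp: is_form_def in_keys_iff)

lemma mon_degree_add: "mon_degree (m + m') = mon_degree m + mon_degree m'"
  by (simp add: mon_degree_def lookup_add sum.distrib)

lemma mon_degree_single [simp]: "mon_degree (Poly_Mapping.single i n) = n"
  by (simp add: mon_degree_def lookup_single when_def)

lemma mon_degree_0_iff: "mon_degree m = 0 \<longleftrightarrow> m = 0"
  by (auto simp: mon_degree_def intro!: poly_mapping_eqI)

lemma is_form_0 [simp]: "is_form d 0"
  by (simp add: is_form_def)

lemma is_form_add: "is_form d F \<Longrightarrow> is_form d G \<Longrightarrow> is_form d (F + G)"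
  by (simp add: is_form_iff lookup_add) (metis add_0)

lemma is_form_uminus: "is_form d F \<Longrightarrow> is_form d (- F :: ('n::finite, 'k::ab_group_add) mpoly)"
  by (auto simp: is_form_iff)

lemma is_form_diff: "is_form d F \<Longrightarrow> is_form d G \<Longrightarrow> is_form d (F - G :: ('n::finite, 'k::ab_group_add) mpoly)"
  using is_form_add[of d F "- G"] is_form_uminus[of d G] by simp

lemma is_form_sum: "(\<And>x. x \<in> A \<Longrightarrow> is_form d (f x)) \<Longrightarrow> is_form d (sum f A)"
  by (induction A rule: infinite_finite_induct) (auto intro: is_form_add)

lemma is_form_mult:
  assumes "is_form d F" "is_form e G"
  shows "is_form (d + e) (F * G :: ('n::finite, 'k::comm_semiring_1) mpoly)"
  using assms Poly_Mapping.keys_mult[of F G] by (fastforce simp: is_form_def mon_degree_add)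

lemma is_form_const: "is_form 0 (const c)"
  by (auto simp: const_def is_form_iff lookup_single when_def mon_degree_0_iff)

lemma is_form_var: "is_form 1 (var i)"
  by (auto simp: var_def is_form_iff lookup_single when_def)

lemma is_form_const_mult: "is_form d F \<Longrightarrow> is_form d (const c * F :: ('n::finite, 'k::comm_semiring_1) mpoly)"
  using is_form_mult[OF is_form_const, of d F c] by simp

lemma is_form_partial_deriv:
  assumes "is_form (Suc d) F"
  shows "is_form d (partial_deriv i F)"
proof (unfold is_form_iff, intro allI impI)
  fix m assume "Poly_Mapping.lookup (partial_deriv i F) m \<noteq> 0"
  then have "Poly_Mapping.lookup F (m + Poly_Mapping.single i 1) \<noteq> 0" by (auto simp: lookup_partial_deriv)
  then have "mon_degree (m + Poly_Mapping.single i 1) = Suc d" using assms by (auto simp: is_form_iff)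
  then show "mon_degree m = d" by (simp add: mon_degree_add)
qed

lemma is_form_0_const: "is_form 0 F \<Longrightarrow> F = const (Poly_Mapping.lookup F 0)"
  by (rule poly_mapping_eqI) (auto simp: is_form_iff const_def lookup_single when_def mon_degree_0_iff)

lemma mon_degree_Suc_ex:
  assumes "mon_degree m = Suc d"
  obtains a m' where "m = Poly_Mapping.single a 1 + m'" "mon_degree m' = d"
proof -
  have "m \<noteq> 0" using assms mon_degree_0_iff[of m] by simp
  then obtain a where a: "Poly_Mapping.lookup m a \<noteq> 0" by (metis lookup_zero poly_mapping_eqI)
  have m: "m = Poly_Mapping.single a 1 + (m - Poly_Mapping.single a 1)"
    using a by (intro poly_mapping_eqI) (auto simp: lookup_add lookup_minus lookup_single when_def)
  then have "mon_degree m = 1 + mon_degree (m - Poly_Mapping.single a 1)"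
    using mon_degree_add[of "Poly_Mapping.single a 1" "m - Poly_Mapping.single a 1"] by simp
  with m that assms show thesis by (metis add_left_cancel plus_1_eq_Suc)
qed

text \<open>
  Euler's formula divides by the degree and is useless in small characteristic. Here each monomial
  is simply assigned to one of the variables that divide it. All inductions over the degree of a
  form use this splitting.
\<close>

lemma form_decomposition:
  fixes F :: "('n::finite, 'k::comm_semiring_1) mpoly"
  assumes "is_form (Suc d) F"
  obtains G where "\<And>a. is_form d (G a)" "F = (\<Sum>a\<in>UNIV. var a * G a)"
proof -
  have "\<exists>G. (\<forall>a. is_form d (G a)) \<and>
      (\<Sum>m\<in>V. Poly_Mapping.single m (Poly_Mapping.lookup F m)) = (\<Sum>a\<in>UNIV. var a * G a)"
    if "finite V" "V \<subseteq> Poly_Mapping.keys F" for V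
    using that
  proof (induction V)
    case empty
    then show ?case by (intro exI[of _ "\<lambda>_. 0"]) simp
  next
    case (insert m V)
    then obtain G where G: "\<forall>a. is_form d (G a)"
      "(\<Sum>m\<in>V. Poly_Mapping.single m (Poly_Mapping.lookup F m)) = (\<Sum>a\<in>UNIV. var a * G a)" by auto
    have "mon_degree m = Suc d" using assms insert.prems by (auto simp: is_form_def)
    then obtain b m' where m: "m = Poly_Mapping.single b 1 + m'" "mon_degree m' = d"
      by (rule mon_degree_Suc_ex)
    define t where "t = Poly_Mapping.single m' (Poly_Mapping.lookup F m)"
    have s: "Poly_Mapping.single m (Poly_Mapping.lookup F m) = var b * t"
      by (simp add: t_def var_def mult_single m(1))
    have t: "is_form d t" using m(2) by (auto simp: t_def is_form_iff lookup_single when_def)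
    define G' where "G' = G(b := G b + t)"
    have "(\<Sum>a\<in>UNIV. var a * G' a) = (\<Sum>a\<in>UNIV. var a * G a + (if a = b then var b * t else 0))"
      by (intro sum.cong) (auto simp: G'_def distrib_left)
    also have "\<dots> = (\<Sum>a\<in>UNIV. var a * G a) + var b * t" by (simp add: sum.distrib)
    finally have "(\<Sum>m\<in>insert m V. Poly_Mapping.single m (Poly_Mapping.lookup F m)) = (\<Sum>a\<in>UNIV. var a * G' a)"
      using insert G s by (simp add: add.commute)
    moreover have "\<forall>a. is_form d (G' a)" using G t by (simp add: G'_def is_form_add)
    ultimately show ?case by blast
  qed
  from this[of "Poly_Mapping.keys F"] that show thesis by (auto simp: mpoly_sum_single)
qed

lemma total_degree_form:
  assumes "is_form d F" "F \<noteq> 0"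
  shows "total_degree F = d"
proof -
  have "mon_degree ` Poly_Mapping.keys F = (\<lambda>_. d) ` Poly_Mapping.keys F"
    using assms(1) by (intro image_cong) (auto simp: is_form_def)
  then have "mon_degree ` Poly_Mapping.keys F = {d}" using assms(2) by (simp add: image_constant_conv)
  then show ?thesis using assms(2) by (simp add: total_degree_def)
qed

text \<open>
  The collapses constructed below all consist of a linear form times a quadratic form. The
  definition of a collapse measures degrees by \<open>total_degree\<close>, which is \<open>0\<close> for the zero form; hence
  the cofactor of a vanishing linear form is replaced by \<open>0\<close>.
\<close>

lemma has_collapse_sum:
  fixes F :: "('n::finite, 'k::comm_semiring_1) mpoly"
  assumes F: "is_form 3 F" "F = (\<Sum>x\<in>I. g x * h x)" and I: "finite I" "card I \<le> k"
    and forms: "\<And>x. x \<in> I \<Longrightarrow> is_form 1 (g x)" "\<And>x. x \<in> I \<Longrightarrow> is_form 2 (h x)"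
  shows "has_collapse k F"
proof (cases "F = 0")
  case True
  then show ?thesis unfolding has_collapse_def by (intro exI[of _ "\<lambda>_. 0"]) simp
next
  case False
  obtain e where e: "bij_betw e {0..<card I} I" using ex_bij_betw_nat_finite[OF I(1)] by blast
  have eI: "e i \<in> I" if "i < card I" for i using e that by (auto simp: bij_betw_def)
  define G where "G i = (if i < card I then g (e i) else 0)" for i
  define H where "H i = (if G i = 0 then 0 else h (e i))" for i
  have "(\<Sum>i<k. G i * H i) = (\<Sum>i\<in>{0..<card I}. G i * H i)"
    using I(2) by (intro sum.mono_neutral_right) (auto simp: G_def)
  also have "\<dots> = (\<Sum>i\<in>{0..<card I}. g (e i) * h (e i))"
    by (intro sum.cong) (auto simp: G_def H_def)
  also have "\<dots> = F" unfolding F(2) by (rule sum.reindex_bij_betw[OF e])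
  finally have FGH: "F = (\<Sum>i<k. G i * H i)" by simp
  have dF: "total_degree F = 3" using F(1) False by (rule total_degree_form)
  have nz: "total_degree (G i) = 1 \<and> is_form 1 (G i) \<and> is_form 2 (H i)" if "G i \<noteq> 0" for i
  proof -
    have "i < card I" using that by (auto simp: G_def split: if_splits)
    then show ?thesis
      using that forms[OF eI] total_degree_form[of 1 "G i"] by (simp add: G_def H_def)
  qed
  have z: "H i = 0" if "G i = 0" for i using that by (simp add: H_def)
  show ?thesis
    unfolding has_collapse_def dF
  proof (rule exI[of _ G], rule exI[of _ H], intro conjI allI impI)
    show "G i = 0 \<or> 0 < total_degree (G i) \<and> total_degree (G i) < 3 \<and> is_form (total_degree (G i)) (G i)" for i
      using nz[of i] by (cases "G i = 0") simp_all
    show "H i = 0 \<or> is_form (3 - total_degree (G i)) (H i)" for i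
      using nz[of i] z[of i] by (cases "G i = 0") simp_all
  qed (rule FGH)
qed

lemma linear_form_ex:
  fixes F :: "('n::finite, 'k::comm_semiring_1) mpoly"
  assumes "is_form 1 F"
  shows "\<exists>w. F = (\<Sum>i\<in>UNIV. const (w i) * var i)"
proof -
  obtain G where G: "\<And>a. is_form 0 (G a)" "F = (\<Sum>a\<in>UNIV. var a * G a)"
    using form_decomposition[of 0 F] assms by auto
  have "F = (\<Sum>i\<in>UNIV. const (Poly_Mapping.lookup (G i) 0) * var i)"
    unfolding G(2)
  proof (intro sum.cong refl)
    show "var i * G i = const (Poly_Mapping.lookup (G i) 0) * var i" for i
      using is_form_0_const[OF G(1), of i] by (simp add: mult.commute)
  qed
  then show ?thesis by (rule exI[of _ "\<lambda>i. Poly_Mapping.lookup (G i) 0"])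
qed

lemma is_form_linear:
  "is_form 1 (\<Sum>i\<in>V. const (w i) * (var i :: ('n::finite, 'k::comm_semiring_1) mpoly))"
  by (intro is_form_sum is_form_const_mult is_form_var)

lemma is_form_msubst:
  assumes B: "\<And>a. is_form 1 (B a)"
  shows "is_form d F \<Longrightarrow> is_form d (msubst B F)"
proof (induction d arbitrary: F)
  case 0
  then show ?case using is_form_0_const[of F] is_form_const by (metis sb.insertion_const)
next
  case (Suc d)
  obtain G where G: "\<And>a. is_form d (G a)" "F = (\<Sum>a\<in>UNIV. var a * G a)"
    using form_decomposition[OF Suc.prems] by blast
  have "is_form (1 + d) (B a * msubst B (G a))" for a
    using is_form_mult[OF B Suc.IH[OF G(1)]] .
  then show ?case
    unfolding G(2) by (simp add: sb.insertion_sum sb.insertion_mult is_form_sum)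
qed

text \<open>
  A form and its image under a linear substitution are congruent modulo the differences between the
  variables and their images. The clause for \<open>d = 0\<close> makes the degrees in the induction step fit,
  because \<open>d - 1\<close> is truncated.
\<close>

lemma msubst_difference:
  fixes F :: "('n::finite, 'k::comm_ring_1) mpoly"
  assumes B: "\<And>a. is_form 1 (B a)"
  shows "is_form d F \<Longrightarrow> \<exists>H. (\<forall>l. is_form (d - 1) (H l) \<and> (d = 0 \<longrightarrow> H l = 0)) \<and>
    F - msubst B F = (\<Sum>l\<in>UNIV. (var l - B l) * H l)"
proof (induction d arbitrary: F)
  case 0
  then have "msubst B F = F" using is_form_0_const[of F] by (metis sb.insertion_const)
  then show ?case by (intro exI[of _ "\<lambda>_. 0"]) simp
next
  case (Suc d)
  obtain G where G: "\<And>a. is_form d (G a)" "F = (\<Sum>a\<in>UNIV. var a * G a)"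
    using form_decomposition[OF Suc.prems] by blast
  have "\<forall>a. \<exists>H. (\<forall>l. is_form (d - 1) (H l) \<and> (d = 0 \<longrightarrow> H l = 0)) \<and>
      G a - msubst B (G a) = (\<Sum>l\<in>UNIV. (var l - B l) * H l)"
    using Suc.IH G(1) by blast
  from choice[OF this] obtain H where H: "\<forall>a. (\<forall>l. is_form (d - 1) (H a l) \<and> (d = 0 \<longrightarrow> H a l = 0)) \<and>
      G a - msubst B (G a) = (\<Sum>l\<in>UNIV. (var l - B l) * H a l)" by blast
  have H1: "is_form (d - 1) (H a l)" "d = 0 \<Longrightarrow> H a l = 0" for a l using H by blast+
  have H2: "G a - msubst B (G a) = (\<Sum>l\<in>UNIV. (var l - B l) * H a l)" for a using H by blast
  define K where "K l = G l + (\<Sum>a\<in>UNIV. B a * H a l)" for l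
  have "is_form d (B a * H a l)" for a l
    using H1[of a l] is_form_mult[OF B H1(1), of a a l] by (cases d) auto
  then have K: "is_form d (K l)" for l unfolding K_def by (intro is_form_add G(1) is_form_sum)
  have "var a * G a - B a * msubst B (G a) = (var a - B a) * G a + B a * (G a - msubst B (G a))" for a
    by (simp add: algebra_simps)
  then have "F - msubst B F = (\<Sum>a\<in>UNIV. (var a - B a) * G a + B a * (G a - msubst B (G a)))"
    by (simp only: G(2) sb.insertion_sum sb.insertion_mult sb.insertion_var flip: sum_subtractf)
  also have "\<dots> = (\<Sum>a\<in>UNIV. (var a - B a) * G a) + (\<Sum>a\<in>UNIV. \<Sum>l\<in>UNIV. (var l - B l) * (B a * H a l))"
    unfolding H2 by (simp add: sum.distrib sum_distrib_left mult.left_commute)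
  also have "(\<Sum>a\<in>UNIV. \<Sum>l\<in>UNIV. (var l - B l) * (B a * H a l)) =
      (\<Sum>l\<in>UNIV. (var l - B l) * (\<Sum>a\<in>UNIV. B a * H a l))"
    by (subst sum.swap) (simp add: sum_distrib_left)
  finally have "F - msubst B F = (\<Sum>l\<in>UNIV. (var l - B l) * K l)"
    by (simp add: K_def distrib_left sum.distrib)
  with K show ?case by auto
qed

lemma partial_deriv_msubst:
  "partial_deriv i (msubst B F) = (\<Sum>a\<in>UNIV. partial_deriv i (B a) * msubst B (partial_deriv a F))"
proof (induction F rule: mpoly_induct)
  case (var j)
  have "(\<Sum>a\<in>UNIV. partial_deriv i (B a) * msubst B (partial_deriv a (var j))) =
      (\<Sum>a\<in>UNIV. if a = j then partial_deriv i (B a) else 0)"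
    by (intro sum.cong) (auto simp: partial_deriv_var)
  then show ?case by simp
next
  case (add F G)
  then show ?case
    by (simp add: sb.insertion_add partial_deriv_add distrib_left sum.distrib)
next
  case (mult F G)
  then show ?case
    by (simp add: sb.insertion_add sb.insertion_mult partial_deriv_mult distrib_left sum.distrib
        sum_distrib_left sum_distrib_right mult_ac)
qed simp

lemma free_of_msubst:
  assumes "\<And>a. free_of i (B a)"
  shows "free_of i (msubst B F)"
  by (induction F rule: mpoly_induct)
     (simp_all add: assms sb.insertion_add sb.insertion_mult free_of_add free_of_mult)

section \<open>The third polar form on a tangent space\<close>

text \<open>
  The heart of the proof. Each \<open>\<partial>\<^sub>l F\<close> vanishes on the variety \<open>V\<close> of \<open>P\<close>. Deriving along a tangent field
  \<open>u\<^sub>j\<close> shows that the Hessian of \<open>F\<close>, applied to \<open>u\<^sub>j\<close>, vanishes on \<open>V\<close>. Deriving once more along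
  \<open>u\<^sub>i\<close> and pairing with \<open>u\<^sub>k\<close>, the terms with derivatives of \<open>u\<^sub>j\<close> disappear by symmetry of the
  Hessian, and what remains is the third polar form of \<open>F\<close> at \<open>(u\<^sub>i, u\<^sub>j, u\<^sub>k)\<close>. At a point of \<open>V\<close>
  with \<open>\<delta> \<noteq> 0\<close> the fields, divided by \<open>\<delta>\<close>, give the vectors \<open>b\<close>.
\<close>

lemma third_polar_vanishes:
  fixes F :: "('n::finite, 'k::alg_closed_field) mpoly"
  assumes P: "is_prime P" and F: "is_form 3 F" and sing: "\<And>l. partial_deriv l F \<in> P"
    and frame: "tangent_frame P J"
  obtains b where "\<And>j l. j \<notin> J \<Longrightarrow> l \<notin> J \<Longrightarrow> b j l = (if l = j then 1 else 0)"
    "\<And>i j k. i \<notin> J \<Longrightarrow> j \<notin> J \<Longrightarrow> k \<notin> J \<Longrightarrow>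
       (\<Sum>l\<in>UNIV. \<Sum>a\<in>UNIV. \<Sum>c\<in>UNIV. b k l * (b j a * (b i c *
          Poly_Mapping.lookup (partial_deriv c (partial_deriv a (partial_deriv l F))) 0))) = 0"
proof -
  obtain \<delta> u where u: "\<delta> \<notin> P" "\<forall>j. j \<notin> J \<longrightarrow>
      (\<forall>l. l \<notin> J \<longrightarrow> u j l = (if l = j then \<delta> else 0)) \<and> (\<forall>g\<in>P. vfield (u j) g \<in> P)"
    using frame unfolding tangent_frame_def by blast
  have uP: "vfield (u j) g \<in> P" if "j \<notin> J" "g \<in> P" for j g using u(2) that by blast
  obtain v where v: "\<And>g. g \<in> P \<Longrightarrow> eval v g = 0" "eval v \<delta> \<noteq> 0"
    using nullstellensatz_prime[OF P u(1)] by blast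
  define T where "T c a l = Poly_Mapping.lookup (partial_deriv c (partial_deriv a (partial_deriv l F))) 0" for c a l
  have T: "partial_deriv c (partial_deriv a (partial_deriv l F)) = const (T c a l)" for c a l
  proof -
    have "is_form (Suc (Suc (Suc 0))) F" using F by (simp add: numeral_3_eq_3)
    then show ?thesis unfolding T_def by (intro is_form_0_const is_form_partial_deriv)
  qed
  have polar: "(\<Sum>l\<in>UNIV. \<Sum>a\<in>UNIV. \<Sum>c\<in>UNIV. eval v (u k l) * (eval v (u j a) * (eval v (u i c) * T c a l))) = 0"
    if ijk: "i \<notin> J" "j \<notin> J" "k \<notin> J" for i j k
  proof -
    have second: "vfield (u i) (vfield (u j) (partial_deriv l F)) =
        (\<Sum>a\<in>UNIV. vfield (u i) (u j a) * partial_deriv a (partial_deriv l F)) +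
        (\<Sum>a\<in>UNIV. \<Sum>c\<in>UNIV. u j a * (u i c * const (T c a l)))" for l
    proof -
      have "vfield (u i) (vfield (u j) (partial_deriv l F)) =
          (\<Sum>a\<in>UNIV. vfield (u i) (u j a) * partial_deriv a (partial_deriv l F) +
             u j a * vfield (u i) (partial_deriv a (partial_deriv l F)))"
        by (subst (2) vfield_def) (simp add: vfield_sum vfield_mult)
      also have "\<dots> = (\<Sum>a\<in>UNIV. vfield (u i) (u j a) * partial_deriv a (partial_deriv l F) +
             u j a * (\<Sum>c\<in>UNIV. u i c * const (T c a l)))"
        by (simp add: vfield_def[of "u i" "partial_deriv _ (partial_deriv l F)"] T)
      finally show ?thesis by (simp add: sum.distrib sum_distrib_left)
    qed
    have "(\<Sum>l\<in>UNIV. u k l * vfield (u i) (vfield (u j) (partial_deriv l F))) \<in> P"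
      using ijk by (intro prime_sum[OF P] prime_mult_left[OF P] uP sing)
    moreover have "(\<Sum>l\<in>UNIV. u k l * (\<Sum>a\<in>UNIV. vfield (u i) (u j a) * partial_deriv a (partial_deriv l F))) \<in> P"
    proof -
      have "(\<Sum>l\<in>UNIV. u k l * (\<Sum>a\<in>UNIV. vfield (u i) (u j a) * partial_deriv a (partial_deriv l F))) =
          (\<Sum>a\<in>UNIV. vfield (u i) (u j a) * (\<Sum>l\<in>UNIV. u k l * partial_deriv a (partial_deriv l F)))"
        unfolding sum_distrib_left by (subst sum.swap) (simp add: mult.left_commute)
      also have "\<dots> = (\<Sum>a\<in>UNIV. vfield (u i) (u j a) * vfield (u k) (partial_deriv a F))"
        by (simp add: vfield_def[of "u k"] partial_deriv_commute)
      also have "\<dots> \<in> P"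
        using ijk by (intro prime_sum[OF P] prime_mult_left[OF P] uP sing)
      finally show ?thesis .
    qed
    ultimately have "(\<Sum>l\<in>UNIV. u k l * vfield (u i) (vfield (u j) (partial_deriv l F))) -
        (\<Sum>l\<in>UNIV. u k l * (\<Sum>a\<in>UNIV. vfield (u i) (u j a) * partial_deriv a (partial_deriv l F))) \<in> P"
      by (rule prime_diff[OF P])
    then have "(\<Sum>l\<in>UNIV. u k l * (\<Sum>a\<in>UNIV. \<Sum>c\<in>UNIV. u j a * (u i c * const (T c a l)))) \<in> P"
      unfolding second by (simp add: distrib_left sum.distrib)
    from v(1)[OF this] show ?thesis
      by (simp add: ev.insertion_sum ev.insertion_mult sum_distrib_left)
  qed
  define b where "b j l = eval v (u j l) / eval v \<delta>" for j l
  show thesis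
  proof (rule that[of b])
    show "b j l = (if l = j then 1 else 0)" if "j \<notin> J" "l \<notin> J" for j l
      using u(2) that v(2) by (simp add: b_def)
    show "(\<Sum>l\<in>UNIV. \<Sum>a\<in>UNIV. \<Sum>c\<in>UNIV. b k l * (b j a * (b i c *
          Poly_Mapping.lookup (partial_deriv c (partial_deriv a (partial_deriv l F))) 0))) = 0"
      if "i \<notin> J" "j \<notin> J" "k \<notin> J" for i j k
    proof -
      have "b k l * (b j a * (b i c * T c a l)) =
          eval v (u k l) * (eval v (u j a) * (eval v (u i c) * T c a l)) / eval v \<delta> ^ 3" for l a c
        by (simp add: b_def power3_eq_cube)
      then show ?thesis using polar[OF that]
        by (simp add: T_def flip: sum_divide_distrib)
    qed
  qed
qed

section \<open>Monomials of cubic forms in small characteristic\<close>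

lemma CHAR_zero:
  assumes "CHAR('k::comm_ring_1) = p"
  shows "of_nat p = (0 :: 'k)" "of_nat p = (0 :: ('n, 'k) mpoly)"
proof -
  show 1: "of_nat p = (0 :: 'k)" using of_nat_CHAR[where 'a = 'k] assms by simp
  show "of_nat p = (0 :: ('n, 'k) mpoly)" by (simp add: 1 flip: const_of_nat)
qed

lemma sum_square_char_2:
  fixes f :: "'a \<Rightarrow> 'b::comm_ring_1"
  assumes "of_nat 2 = (0 :: 'b)"
  shows "(\<Sum>x\<in>V. f x) ^ 2 = (\<Sum>x\<in>V. f x ^ 2)"
  using assms by (induction V rule: infinite_finite_induct) (simp_all add: power2_sum)

lemma sum_cube_char_3:
  fixes f :: "'a \<Rightarrow> 'b::comm_ring_1"
  assumes "of_nat 3 = (0 :: 'b)"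
  shows "(\<Sum>x\<in>V. f x) ^ 3 = (\<Sum>x\<in>V. f x ^ 3)"
proof (induction V rule: infinite_finite_induct)
  case (insert x V)
  have "(a + b) ^ 3 = a ^ 3 + b ^ 3 + of_nat 3 * (a * a * b + a * b * b)" for a b :: 'b
    by (simp add: power3_eq_cube algebra_simps)
  then have "(a + b) ^ 3 = a ^ 3 + b ^ 3" for a b :: 'b using assms by (simp only: mult_zero_left add_0_right)
  with insert show ?case by simp
qed simp_all

lemma mpoly_sum_image:
  assumes "finite I" "inj_on f I" "Poly_Mapping.keys F \<subseteq> f ` I"
  shows "F = (\<Sum>x\<in>I. Poly_Mapping.single (f x) (Poly_Mapping.lookup F (f x)))"
proof -
  have "F = (\<Sum>m\<in>Poly_Mapping.keys F. Poly_Mapping.single m (Poly_Mapping.lookup F m))"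
    by (rule mpoly_sum_single[symmetric])
  also have "\<dots> = (\<Sum>m\<in>f ` I. Poly_Mapping.single m (Poly_Mapping.lookup F m))"
    using assms by (intro sum.mono_neutral_left) (auto simp: in_keys_iff)
  also have "\<dots> = (\<Sum>x\<in>I. Poly_Mapping.single (f x) (Poly_Mapping.lookup F (f x)))"
    using assms by (simp add: sum.reindex)
  finally show ?thesis .
qed

abbreviation \<epsilon> :: "'n \<Rightarrow> 'n \<Rightarrow>\<^sub>0 nat" where
  "\<epsilon> i \<equiv> Poly_Mapping.single i 1"

lemma cubic_monomial:
  assumes "is_form 3 F" "\<And>l. l \<in> J \<Longrightarrow> free_of l F" "m \<in> Poly_Mapping.keys F"
  obtains i j k where "m = \<epsilon> i + \<epsilon> j + \<epsilon> k" "i \<notin> J" "j \<notin> J" "k \<notin> J"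
proof -
  have "mon_degree m = Suc (Suc (Suc 0))" using assms by (simp add: is_form_def)
  then obtain i m1 where 1: "m = \<epsilon> i + m1" "mon_degree m1 = Suc (Suc 0)" by (rule mon_degree_Suc_ex)
  obtain j m2 where 2: "m1 = \<epsilon> j + m2" "mon_degree m2 = Suc 0" using 1(2) by (rule mon_degree_Suc_ex)
  obtain k m3 where 3: "m2 = \<epsilon> k + m3" "mon_degree m3 = 0" using 2(2) by (rule mon_degree_Suc_ex)
  have m: "m = \<epsilon> i + \<epsilon> j + \<epsilon> k" using 1 2 3 by (simp add: mon_degree_0_iff add_ac)
  have "l \<notin> J" if "Poly_Mapping.lookup m l \<noteq> 0" for l
    using assms(2)[of l] assms(3) that by (auto simp: free_of_def in_keys_iff)
  with m that show thesis by (simp add: lookup_add lookup_single)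
qed

lemma lookup_third_partial:
  "Poly_Mapping.lookup (partial_deriv i (partial_deriv j (partial_deriv k F))) 0 =
     (if j = i then 2 else 1) * (of_nat ((if k = i then 1 else 0) + (if k = j then 1 else 0) + 1) *
       Poly_Mapping.lookup F (\<epsilon> i + \<epsilon> j + \<epsilon> k))"
  by (auto simp: lookup_partial_deriv lookup_add lookup_single when_def)

section \<open>Collapses from the restriction to a tangent space\<close>

text \<open>
  The data provided by \<open>third_polar_vanishes\<close>: the vectors \<open>b\<^sub>j\<close> with \<open>j \<notin> J\<close> form a basis of a tangent
  space \<open>T\<close> of codimension \<open>card J\<close>, on which the third polar form of \<open>F\<close> vanishes.
\<close>

locale tangent_section =
  fixes F :: "('n::finite, 'k::alg_closed_field) mpoly" and P J b
  assumes P: "is_prime P" and F: "is_form 3 F" and sing: "\<And>l. partial_deriv l F \<in> P"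
    and b: "\<And>j l. j \<notin> J \<Longrightarrow> l \<notin> J \<Longrightarrow> b j l = (if l = j then 1 else (0 :: 'k))"
    and polar: "\<And>i j k. i \<notin> J \<Longrightarrow> j \<notin> J \<Longrightarrow> k \<notin> J \<Longrightarrow>
       (\<Sum>l\<in>UNIV. \<Sum>a\<in>UNIV. \<Sum>c\<in>UNIV. b k l * (b j a * (b i c *
          Poly_Mapping.lookup (partial_deriv c (partial_deriv a (partial_deriv l F))) 0))) = 0"
begin

text \<open>
  The substitution \<open>x\<^sub>a \<mapsto> B\<^sub>a\<close> restricts functions to \<open>T\<close>, with the variables outside \<open>J\<close> as linear
  coordinates on \<open>T\<close>. The differences \<open>x\<^sub>l - B\<^sub>l\<close> with \<open>l \<in> J\<close> are the equations of \<open>T\<close>.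
\<close>

definition B :: "'n \<Rightarrow> ('n, 'k) mpoly" where
  "B a = (\<Sum>j\<in>-J. const (b j a) * var j)"

text \<open>
  The restriction of \<open>F\<close> to \<open>T\<close>.
\<close>

definition Fs :: "('n, 'k) mpoly" where
  "Fs = msubst B F"

lemma B_form: "is_form 1 (B a)"
  unfolding B_def by (rule is_form_linear)

lemma B_outside: "a \<notin> J \<Longrightarrow> B a = var a"
proof -
  assume a: "a \<notin> J"
  have "B a = (\<Sum>j\<in>-J. if j = a then var j else 0)"
    unfolding B_def using a b by (intro sum.cong) auto
  then show ?thesis using a by simp
qed

lemma partial_deriv_B: "j \<notin> J \<Longrightarrow> partial_deriv j (B a) = const (b j a)"
proof -
  assume j: "j \<notin> J"
  have "partial_deriv j (B a) = (\<Sum>i\<in>-J. if i = j then const (b i a) else 0)"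
    unfolding B_def partial_deriv_sum by (intro sum.cong) (auto simp: partial_deriv_mult partial_deriv_var)
  then show ?thesis using j by simp
qed

lemma Fs_form: "is_form 3 Fs"
  unfolding Fs_def by (rule is_form_msubst[OF B_form F])

lemma Fs_free: "l \<in> J \<Longrightarrow> free_of l Fs"
  unfolding Fs_def B_def by (intro free_of_msubst free_of_sum free_of_mult free_of_const free_of_var) auto

text \<open>
  Up to a collapse with \<open>card J\<close> summands, \<open>F\<close> may be replaced by its restriction to \<open>T\<close>.
\<close>

lemma section_decomposition:
  obtains H where "\<forall>l. is_form 2 (H l)" "F = Fs + (\<Sum>l\<in>J. (var l - B l) * H l)"
proof -
  from msubst_difference[OF B_form F] obtain H where
    "(\<forall>l. is_form (3 - 1) (H l) \<and> ((3::nat) = 0 \<longrightarrow> H l = 0)) \<and>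
      F - msubst B F = (\<Sum>l\<in>UNIV. (var l - B l) * H l)" by (rule exE)
  then have H: "\<forall>l. is_form 2 (H l)" "F - Fs = (\<Sum>l\<in>UNIV. (var l - B l) * H l)"
    by (simp_all add: Fs_def)
  have "(\<Sum>l\<in>UNIV. (var l - B l) * H l) = (\<Sum>l\<in>J. (var l - B l) * H l)"
    by (rule sum.mono_neutral_right) (auto simp: B_outside)
  then have "F = Fs + (\<Sum>l\<in>J. (var l - B l) * H l)" using H(2) by (simp add: diff_eq_eq add.commute)
  then show thesis by (rule that[OF H(1)])
qed

lemma partial_deriv_section:
  "j \<notin> J \<Longrightarrow> partial_deriv j (msubst B G) = (\<Sum>a\<in>UNIV. const (b j a) * msubst B (partial_deriv a G))"
  by (simp add: partial_deriv_msubst partial_deriv_B)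

lemma third_partial_Fs:
  assumes ijk: "i \<notin> J" "j \<notin> J" "k \<notin> J"
  shows "partial_deriv i (partial_deriv j (partial_deriv k Fs)) = 0"
proof -
  define T where "T c a l = Poly_Mapping.lookup (partial_deriv c (partial_deriv a (partial_deriv l F))) 0" for c a l
  have T: "partial_deriv c (partial_deriv a (partial_deriv l F)) = const (T c a l)" for c a l
  proof -
    have "is_form (Suc (Suc (Suc 0))) F" using F by (simp add: numeral_3_eq_3)
    then show ?thesis unfolding T_def by (intro is_form_0_const is_form_partial_deriv)
  qed
  have pc: "partial_deriv x (const c * G) = const c * partial_deriv x G" for x c and G :: "('n, 'k) mpoly"
    by (simp add: partial_deriv_mult)
  have "partial_deriv i (partial_deriv j (partial_deriv k Fs)) =
      (\<Sum>l\<in>UNIV. \<Sum>a\<in>UNIV. \<Sum>c\<in>UNIV. const (b k l) * (const (b j a) * (const (b i c) * const (T c a l))))"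
    by (simp only: Fs_def ijk[THEN partial_deriv_section] partial_deriv_sum pc sum_distrib_left T sb.insertion_const)
  also have "\<dots> = const (\<Sum>l\<in>UNIV. \<Sum>a\<in>UNIV. \<Sum>c\<in>UNIV. b k l * (b j a * (b i c * T c a l)))"
    by (simp only: const_sum const_mult)
  finally show ?thesis by (simp only: T_def polar[OF ijk] const_0)
qed

lemma lookup_Fs_distinct:
  assumes "i \<notin> J" "j \<notin> J" "k \<notin> J" "i \<noteq> j" "i \<noteq> k" "j \<noteq> k"
  shows "Poly_Mapping.lookup Fs (\<epsilon> i + \<epsilon> j + \<epsilon> k) = 0"
  using lookup_third_partial[of i j k Fs] third_partial_Fs[OF assms(1-3)] assms(4-6) by auto

text \<open>
  The factor \<open>2\<close> is the reason why characteristic \<open>2\<close> needs the additional argument in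
  \<open>collapse_char_2\<close>.
\<close>

lemma lookup_Fs_square:
  assumes "i \<notin> J" "k \<notin> J" "i \<noteq> k"
  shows "2 * Poly_Mapping.lookup Fs (\<epsilon> i + \<epsilon> i + \<epsilon> k) = 0"
  using lookup_third_partial[of i i k Fs] third_partial_Fs[of i i k] assms by auto

text \<open>
  As \<open>2\<close> is invertible, only cubes of variables survive in the restriction of \<open>F\<close> to \<open>T\<close>. A
  combination of cubes is the cube of a linear form, which costs one more summand.
\<close>

lemma collapse_char_3:
  assumes ch: "CHAR('k) = 3"
  shows "has_collapse (card J + 1) F"
proof -
  have two: "(2 :: 'k) \<noteq> 0"
  proof
    assume "(2 :: 'k) = 0"
    moreover have "(3 :: 'k) = 0" using CHAR_zero(1)[OF ch] by simp
    ultimately have "(3 :: 'k) - 2 = 0" by simp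
    then show False by simp
  qed
  have sq: "Poly_Mapping.lookup Fs (\<epsilon> i + \<epsilon> i + \<epsilon> k) = 0" if "i \<notin> J" "k \<notin> J" "i \<noteq> k" for i k
    using lookup_Fs_square[OF that] two by simp
  define f where "f i = \<epsilon> i + \<epsilon> i + \<epsilon> i" for i :: 'n
  have keys: "Poly_Mapping.keys Fs \<subseteq> f ` (- J)"
  proof
    fix m assume m: "m \<in> Poly_Mapping.keys Fs"
    obtain i j k where ijk: "m = \<epsilon> i + \<epsilon> j + \<epsilon> k" "i \<notin> J" "j \<notin> J" "k \<notin> J"
      using cubic_monomial[OF Fs_form Fs_free m] by blast
    have nz: "Poly_Mapping.lookup Fs (\<epsilon> i + \<epsilon> j + \<epsilon> k) \<noteq> 0" using m ijk(1) by (simp add: in_keys_iff)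
    have "i = j \<and> j = k"
    proof (rule ccontr)
      assume "\<not> (i = j \<and> j = k)"
      then consider "i \<noteq> j" "i \<noteq> k" "j \<noteq> k" | "i = j" "i \<noteq> k" | "i = k" "i \<noteq> j" | "j = k" "i \<noteq> j"
        by blast
      then show False
        using nz lookup_Fs_distinct[of i j k] sq[of i k] sq[of i j] sq[of j i] ijk(2-4)
        by cases (auto simp: add_ac)
    qed
    with ijk show "m \<in> f ` (- J)" by (auto simp: f_def)
  qed
  have inj: "inj_on f (- J)"
  proof (rule inj_onI)
    fix i j assume "f i = f j"
    then have "Poly_Mapping.lookup (f i) i = Poly_Mapping.lookup (f j) i" by simp
    then show "i = j" by (auto simp: f_def lookup_add lookup_single when_def split: if_splits)
  qed
  have "\<exists>y. y ^ 3 = Poly_Mapping.lookup Fs (f i)" for i using nth_root_exists[of 3] by simp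
  then have "\<forall>i. \<exists>y. y ^ 3 = Poly_Mapping.lookup Fs (f i)" by (rule allI)
  from choice[OF this] obtain r where r: "\<And>i. r i ^ 3 = Poly_Mapping.lookup Fs (f i)" by blast
  define M where "M = (\<Sum>i\<in>-J. const (r i) * (var i :: ('n, 'k) mpoly))"
  have "Poly_Mapping.single (f i) (r i ^ 3) = (const (r i) * (var i :: ('n, 'k) mpoly)) ^ 3" for i
  proof -
    have "f i = Poly_Mapping.single i 3"
      by (rule poly_mapping_eqI) (simp add: f_def lookup_add lookup_single when_def)
    then show ?thesis
      by (simp add: power_mult_distrib var_power mult_single const_def flip: const_power[unfolded const_def])
  qed
  then have "Fs = (\<Sum>i\<in>-J. (const (r i) * var i) ^ 3)"
    using mpoly_sum_image[OF _ inj keys] by (simp add: r)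
  then have FsM: "Fs = M ^ 3"
    unfolding M_def by (subst sum_cube_char_3[OF CHAR_zero(2)[OF ch]])
  obtain H where H: "\<forall>l. is_form 2 (H l)" "F = Fs + (\<Sum>l\<in>J. (var l - B l) * H l)"
    by (rule section_decomposition)
  define g where "g x = (case x of None \<Rightarrow> M | Some l \<Rightarrow> var l - B l)" for x
  define h where "h x = (case x of None \<Rightarrow> M ^ 2 | Some l \<Rightarrow> H l)" for x
  have M: "is_form 1 M" unfolding M_def by (rule is_form_linear)
  have M2: "is_form 2 (M ^ 2)" using is_form_mult[OF M M] by (simp add: power2_eq_square numeral_2_eq_2)
  show ?thesis
  proof (rule has_collapse_sum[OF F, of g h "insert None (Some ` J)"])
    show "F = (\<Sum>x\<in>insert None (Some ` J). g x * h x)"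
      by (rule trans[OF H(2)]) (simp add: FsM g_def h_def sum.reindex power3_eq_cube power2_eq_square mult.assoc)
    show "card (insert None (Some ` J)) \<le> card J + 1" by (simp add: card_image card_insert_if)
    show "is_form 1 (g x)" for x
      using M is_form_diff[OF is_form_var B_form] by (cases x) (simp_all add: g_def)
    show "is_form 2 (h x)" for x by (auto simp: h_def M2 H split: option.split)
  qed simp
qed

text \<open>
  The restriction of \<open>F\<close> to \<open>T\<close> has only monomials \<open>x\<^sub>i\<^sup>2 x\<^sub>j\<close>, so that it equals \<open>\<Sum>\<^sub>j M\<^sub>j\<^sup>2 x\<^sub>j\<close> for linear
  forms \<open>M\<^sub>j\<close>. The derivative of \<open>F\<close> in the direction \<open>b\<^sub>j\<close> lies in \<open>P\<close>, and on \<open>T\<close> it equals \<open>M\<^sub>j\<^sup>2\<close>,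
  since squares have derivative zero. So every square of a linear combination of the \<open>M\<^sub>j\<close> lies in
  \<open>P\<close> modulo the equations of \<open>T\<close>, and \<open>card_squares_le\<close> bounds the rank of the \<open>M\<^sub>j\<close>. Expressing
  them in a basis yields a collapse with as many further summands as this rank.
\<close>

lemma collapse_char_2:
  assumes ch: "CHAR('k) = 2" and A: "\<forall>g\<in>P. (\<forall>l\<in>A. free_of l g) \<longrightarrow> g = 0"
  shows "has_collapse (card J + card A) F"
proof -
  note two = CHAR_zero(1)[OF ch] CHAR_zero(2)[OF ch, where 'n = 'n]
  have double: "x + x = 0" for x :: "('n, 'k) mpoly"
  proof -
    have "x + x = of_nat 2 * x" by (simp only: of_nat_numeral mult_2)
    then show ?thesis by (simp only: two mult_zero_left)
  qed
  define f where "f = (\<lambda>(i :: 'n, j). \<epsilon> i + \<epsilon> i + \<epsilon> j)"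
  have keys: "Poly_Mapping.keys Fs \<subseteq> f ` ((-J) \<times> (-J))"
  proof
    fix m assume m: "m \<in> Poly_Mapping.keys Fs"
    obtain i j k where ijk: "m = \<epsilon> i + \<epsilon> j + \<epsilon> k" "i \<notin> J" "j \<notin> J" "k \<notin> J"
      using cubic_monomial[OF Fs_form Fs_free m] by blast
    have "\<not> (i \<noteq> j \<and> i \<noteq> k \<and> j \<noteq> k)"
      using lookup_Fs_distinct[of i j k] ijk m by (auto simp: in_keys_iff)
    then consider "i = j" | "i = k" | "j = k" by blast
    then obtain x where "x \<in> (-J) \<times> (-J)" "m = f x"
    proof cases
      case 1 with ijk that[of "(i, k)"] show thesis by (simp add: f_def)
    next
      case 2 with ijk that[of "(i, j)"] show thesis by (simp add: f_def add_ac)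
    next
      case 3 with ijk that[of "(j, i)"] show thesis by (simp add: f_def add_ac)
    qed
    then show "m \<in> f ` ((-J) \<times> (-J))" by blast
  qed
  have inj: "inj_on f ((-J) \<times> (-J))"
  proof (rule inj_onI, clarify)
    fix i j i' j' assume eq: "f (i, j) = f (i', j')"
    \<comment> \<open>the variable that occurs linearly is the one with odd exponent\<close>
    have "odd (Poly_Mapping.lookup (f (i', j')) j)"
      unfolding eq[symmetric] by (simp add: f_def lookup_add)
    then have j: "j = j'" by (auto simp: f_def lookup_add lookup_single when_def split: if_splits)
    have "Poly_Mapping.lookup (f (i, j)) i = Poly_Mapping.lookup (f (i', j')) i" by (simp add: eq)
    then show "i = i' \<and> j = j'" using j by (auto simp: f_def lookup_add lookup_single when_def split: if_splits)
  qed
  have "\<exists>y. y ^ 2 = Poly_Mapping.lookup Fs (f (i, j))" for i j using nth_root_exists[of 2] by simp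
  then have "\<forall>x. \<exists>y. y ^ 2 = Poly_Mapping.lookup Fs (f x)" by auto
  from choice[OF this] obtain r' where r': "\<And>x. r' x ^ 2 = Poly_Mapping.lookup Fs (f x)" by blast
  define r where "r j i = r' (i, j)" for i j
  have r: "r j i ^ 2 = Poly_Mapping.lookup Fs (f (i, j))" for i j by (simp add: r_def r')
  \<comment> \<open>the entries at \<open>J\<close> are set to \<open>0\<close>, so that all pivots lie outside \<open>J\<close>\<close>
  define row where "row j i = (if i \<in> J then 0 else r j i)" for j i
  define lin where "lin w = (\<Sum>i\<in>UNIV. const (w i) * (var i :: ('n, 'k) mpoly))" for w
  define M where "M j = lin (row j)" for j
  have lin_comb: "lin (\<lambda>i. \<Sum>j\<in>V. c j * w j i) = (\<Sum>j\<in>V. const (c j) * lin (w j))" for V :: "'n set" and c w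
    unfolding lin_def
    by (simp add: const_sum const_mult sum_distrib_left sum_distrib_right mult.assoc) (rule sum.swap)
  have M2: "M j ^ 2 = (\<Sum>i\<in>-J. const (Poly_Mapping.lookup Fs (f (i, j))) * var i ^ 2)" for j
  proof -
    have "M j ^ 2 = (\<Sum>i\<in>UNIV. (const (row j i) * var i) ^ 2)"
      unfolding M_def lin_def by (rule sum_square_char_2[OF two(2)])
    also have "\<dots> = (\<Sum>i\<in>-J. (const (row j i) * var i) ^ 2)"
      by (rule sum.mono_neutral_right) (auto simp: row_def)
    also have "\<dots> = (\<Sum>i\<in>-J. const (Poly_Mapping.lookup Fs (f (i, j))) * var i ^ 2)"
      by (intro sum.cong) (auto simp: row_def power_mult_distrib r simp flip: const_power)
    finally show ?thesis .
  qed
  have FsM: "Fs = (\<Sum>j\<in>-J. M j ^ 2 * var j)"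
  proof -
    have single: "Poly_Mapping.single (f (i, j)) c = const c * var i ^ 2 * var j" for i j and c :: 'k
      by (simp add: f_def const_def var_def power2_eq_square mult_single)
    have "Fs = (\<Sum>x\<in>(-J) \<times> (-J). Poly_Mapping.single (f x) (Poly_Mapping.lookup Fs (f x)))"
      by (rule mpoly_sum_image[OF _ inj keys]) simp
    also have "\<dots> = (\<Sum>i\<in>-J. \<Sum>j\<in>-J. Poly_Mapping.single (f (i, j)) (Poly_Mapping.lookup Fs (f (i, j))))"
      by (simp add: sum.cartesian_product)
    also have "\<dots> = (\<Sum>j\<in>-J. M j ^ 2 * var j)"
      unfolding single M2 by (subst sum.swap) (simp add: sum_distrib_right)
    finally show ?thesis .
  qed
  obtain H where H: "\<forall>l. is_form 2 (H l)" "F = Fs + (\<Sum>l\<in>J. (var l - B l) * H l)"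
    by (rule section_decomposition)
  define D where "D j = vfield (\<lambda>l. const (b j l) :: ('n, 'k) mpoly)" for j
  have D_sq: "D j (G ^ 2) = 0" for j G
    by (simp add: D_def power2_eq_square vfield_mult mult.commute double)
  have DF: "D j F \<in> P" for j
    unfolding D_def vfield_def by (intro prime_sum[OF P] prime_mult_left[OF P] sing)
  have DF_eq: "D j F = M j ^ 2 + (\<Sum>l\<in>J. (var l - B l) * D j (H l))" if j: "j \<notin> J" for j
  proof -
    have "D j (B l) = const (b j l)" for l
    proof -
      have "D j (B l) = (\<Sum>i\<in>-J. if i = j then const (b i l) else 0)"
        unfolding B_def D_def vfield_sum using j b
        by (intro sum.cong) (auto simp: vfield_mult)
      then show ?thesis using j by simp
    qed
    then have "D j (var l - B l) = 0" for l
      using vfield_add[of "\<lambda>l. const (b j l)" "var l - B l" "B l"] by (simp add: D_def)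
    then have "D j ((var l - B l) * H l) = (var l - B l) * D j (H l)" for l
      by (simp add: D_def vfield_mult)
    moreover have "D j Fs = M j ^ 2"
    proof -
      have "D j (M i ^ 2 * var i) = (if i = j then M i ^ 2 else 0)" if "i \<notin> J" for i
        using D_sq[of j "M i"] j b that by (simp add: D_def vfield_mult)
      moreover have "D j Fs = (\<Sum>i\<in>-J. D j (M i ^ 2 * var i))"
        by (subst FsM) (simp add: D_def vfield_sum)
      ultimately have "D j Fs = (\<Sum>i\<in>-J. if i = j then M i ^ 2 else 0)" by simp
      then show ?thesis using j by simp
    qed
    ultimately show ?thesis
      by (subst H(2)) (simp add: D_def vfield_add vfield_sum)
  qed
  define W where "W = {\<lambda>i. \<Sum>j\<in>-J. c j * row j i | c. True}"
  have W_add: "(\<lambda>i. v i + w i) \<in> W" if "v \<in> W" "w \<in> W" for v w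
  proof -
    obtain c d where "v = (\<lambda>i. \<Sum>j\<in>-J. c j * row j i)" "w = (\<lambda>i. \<Sum>j\<in>-J. d j * row j i)"
      using \<open>v \<in> W\<close> \<open>w \<in> W\<close> by (auto simp: W_def)
    then have "(\<lambda>i. v i + w i) = (\<lambda>i. \<Sum>j\<in>-J. (c j + d j) * row j i)"
      by (simp add: distrib_right sum.distrib)
    then show ?thesis unfolding W_def by (intro CollectI exI[of _ "\<lambda>j. c j + d j"] conjI TrueI)
  qed
  have W_scale: "(\<lambda>i. x * w i) \<in> W" if w: "w \<in> W" for x w
  proof -
    obtain c where "w = (\<lambda>i. \<Sum>j\<in>-J. c j * row j i)" using w by (auto simp: W_def)
    then have "(\<lambda>i. x * w i) = (\<lambda>i. \<Sum>j\<in>-J. (x * c j) * row j i)"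
      by (simp add: sum_distrib_left mult.assoc)
    then show ?thesis unfolding W_def by (intro CollectI exI[of _ "\<lambda>j. x * c j"] conjI TrueI)
  qed
  obtain S s where basis: "\<forall>p\<in>S. s p \<in> W"
    "\<forall>p\<in>S. \<forall>p'\<in>S. s p p' = (if p' = p then 1 else 0)"
    "\<forall>w\<in>W. \<forall>i. w i = (\<Sum>p\<in>S. w p * s p i)"
    by (rule ex_reduced_basis[of W, OF W_add W_scale])
  have sW: "s p \<in> W" if "p \<in> S" for p using basis(1) that by blast
  have sd: "s p p' = (if p' = p then 1 else 0)" if "p \<in> S" "p' \<in> S" for p p'
    using basis(2) that by blast
  have sb: "w i = (\<Sum>p\<in>S. w p * s p i)" if "w \<in> W" for w i using basis(3) that by blast
  have WJ: "w i = 0" if "w \<in> W" "i \<in> J" for w i using that by (auto simp: W_def row_def)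
  have SJ: "p \<notin> J" if "p \<in> S" for p using sd[OF that that] WJ[OF sW[OF that]] by auto
  have rowW: "row j \<in> W" if "j \<notin> J" for j
  proof -
    have "(\<Sum>j'\<in>-J. (if j' = j then 1 else 0) * row j' i) = (\<Sum>j'\<in>-J. if j' = j then row j' i else 0)" for i
      by (intro sum.cong) auto
    then have "row j = (\<lambda>i. \<Sum>j'\<in>-J. (if j' = j then 1 else 0) * row j' i)"
      using that by (simp add: fun_eq_iff)
    then show ?thesis unfolding W_def by (intro CollectI exI[of _ "\<lambda>j'. if j' = j then 1 else 0"] conjI TrueI)
  qed
  \<comment> \<open>coordinates: the reduced basis of the \<open>M\<^sub>j\<close> at the pivots, the equations of \<open>T\<close> at \<open>J\<close>\<close>
  define L where "L a = (if a \<in> S then lin (s a) else if a \<in> J then var a - B a else var a)" for a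
  have M_L: "M j = (\<Sum>p\<in>S. const (row j p) * L p)" if "j \<notin> J" for j
  proof -
    have "row j = (\<lambda>i. \<Sum>p\<in>S. row j p * s p i)" using sb[OF rowW[OF that]] by (rule ext)
    then have "M j = lin (\<lambda>i. \<Sum>p\<in>S. row j p * s p i)" by (simp only: M_def)
    then show ?thesis by (simp add: lin_comb L_def)
  qed
  have L_outside: "L a = var a" if "a \<notin> J" "a \<notin> S" for a using that by (simp add: L_def)
  have var_outside: "var a \<in> kspan L" if a: "a \<notin> J" for a
  proof (cases "a \<in> S")
    case True
    have "lin (s a) = var a + (\<Sum>i\<in>-S - J. const (s a i) * var i)"
    proof -
      have "lin (s a) = (\<Sum>i\<in>insert a (-S - J). const (s a i) * var i)"
        unfolding lin_def
        by (rule sum.mono_neutral_right) (use True sd WJ[OF sW] in auto)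
      then show ?thesis using True sd by simp
    qed
    then have "var a = L a - (\<Sum>i\<in>-S - J. const (s a i) * L i)"
      using True by (simp add: L_def)
    then show ?thesis by (simp add: kspan_diff kspan_base kspan_sum kspan_scale)
  next
    case False
    with kspan_base[of L a] show ?thesis by (simp add: L_outside a)
  qed
  have B_in_kspan: "B a \<in> kspan L" for a unfolding B_def by (intro kspan_sum kspan_scale var_outside) simp
  have var_in_kspan: "var a \<in> kspan L" for a
  proof (cases "a \<in> J")
    case True
    then have "var a = L a + B a" using SJ by (auto simp: L_def)
    then show ?thesis by (simp add: kspan_add kspan_base B_in_kspan)
  qed (rule var_outside)
  have linear_in_kspan: "G \<in> kspan L" if "is_form 1 G" for G
  proof -
    obtain w where "G = (\<Sum>i\<in>UNIV. const (w i) * var i)" using linear_form_ex[OF \<open>is_form 1 G\<close>] by blast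
    then show ?thesis by (simp add: kspan_sum kspan_scale var_in_kspan)
  qed
  have DH: "is_form 1 (D j (H l))" for j l
    unfolding D_def vfield_def using H(1)
    by (intro is_form_sum is_form_const_mult is_form_partial_deriv) (simp add: numeral_2_eq_2)
  interpret square_relations P L S
  proof (rule square_relations.intro)
    show "is_prime P" by (rule P)
    show "var a \<in> kspan L" for a by (rule var_in_kspan)
    fix p assume p: "p \<in> S"
    obtain c where c: "s p = (\<lambda>i. \<Sum>j\<in>-J. c j * row j i)" using sW[OF p] by (auto simp: W_def)
    have "L p = (\<Sum>j\<in>-J. const (c j) * M j)" using p by (simp add: L_def c lin_comb M_def)
    then have Lp: "L p ^ 2 = (\<Sum>j\<in>-J. const (c j ^ 2) * M j ^ 2)"
      by (simp add: sum_square_char_2[OF two(2)] power_mult_distrib const_power)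
    define h where "h l = (if l \<in> J then - (\<Sum>j\<in>-J. const (c j ^ 2) * D j (H l)) else 0)" for l
    have h_in_kspan: "h l \<in> kspan L" for l
    proof (rule linear_in_kspan)
      have "is_form 1 (- (\<Sum>j\<in>-J. const (c j ^ 2) * D j (H l)))"
        by (intro is_form_uminus is_form_sum is_form_const_mult DH)
      then show "is_form 1 (h l)" by (simp add: h_def)
    qed
    have "(\<Sum>l\<in>-S. L l * h l) = (\<Sum>l\<in>J. L l * h l)"
      by (rule sum.mono_neutral_right) (use SJ in \<open>auto simp: h_def\<close>)
    also have "\<dots> = (\<Sum>l\<in>J. (var l - B l) * - (\<Sum>j\<in>-J. const (c j ^ 2) * D j (H l)))"
      by (intro sum.cong) (use SJ in \<open>auto simp: h_def L_def\<close>)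
    also have "\<dots> = - (\<Sum>j\<in>-J. const (c j ^ 2) * (\<Sum>l\<in>J. (var l - B l) * D j (H l)))"
      unfolding sum_distrib_left mult_minus_right sum_negf
      by (subst sum.swap) (simp only: mult.left_commute)
    finally have "L p ^ 2 - (\<Sum>l\<in>-S. L l * h l) = (\<Sum>j\<in>-J. const (c j ^ 2) * D j F)"
      by (simp add: Lp DF_eq distrib_left sum.distrib)
    also have "\<dots> \<in> P" by (intro prime_sum[OF P] prime_mult_left[OF P] DF)
    finally show "\<exists>h. (\<forall>b. h b \<in> kspan L) \<and> L p ^ 2 - (\<Sum>b\<in>-S. L b * h b) \<in> P"
      using h_in_kspan by blast
  qed
  have card: "card S \<le> card A" by (rule card_squares_le[OF A])
  define K where "K p = L p * (\<Sum>j\<in>-J. const (row j p ^ 2) * var j)" for p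
  have Fs_L: "Fs = (\<Sum>p\<in>S. L p * K p)"
  proof -
    have "Fs = (\<Sum>j\<in>-J. (\<Sum>p\<in>S. (const (row j p) * L p) ^ 2) * var j)"
      unfolding FsM by (intro sum.cong refl) (simp add: M_L sum_square_char_2[OF two(2)])
    also have "\<dots> = (\<Sum>p\<in>S. \<Sum>j\<in>-J. (const (row j p) * L p) ^ 2 * var j)"
      unfolding sum_distrib_right by (rule sum.swap)
    also have "\<dots> = (\<Sum>p\<in>S. L p * K p)"
      by (intro sum.cong refl) (simp add: K_def sum_distrib_left const_mult power2_eq_square mult_ac)
    finally show ?thesis .
  qed
  have "is_form 1 (var a :: ('n, 'k) mpoly)" for a by (rule is_form_var)
  then have L_form: "is_form 1 (L a)" for a
    using is_form_linear[of "s a" UNIV] is_form_diff[OF is_form_var B_form, of a a]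
    by (simp add: L_def lin_def)
  have K_form: "is_form 2 (K a)" for a
    using is_form_mult[OF L_form is_form_linear[of "\<lambda>j. row j a ^ 2" "- J"], of a] by (simp add: K_def numeral_2_eq_2)
  have disj: "J \<inter> S = {}" using SJ by blast
  show ?thesis
  proof (rule has_collapse_sum[OF F, of L "\<lambda>a. if a \<in> J then H a else K a" "J \<union> S"])
    have "(\<Sum>x\<in>J \<union> S. L x * (if x \<in> J then H x else K x)) =
        (\<Sum>x\<in>J. L x * (if x \<in> J then H x else K x)) + (\<Sum>x\<in>S. L x * (if x \<in> J then H x else K x))"
      using disj by (intro sum.union_disjoint) auto
    also have "(\<Sum>x\<in>J. L x * (if x \<in> J then H x else K x)) = (\<Sum>l\<in>J. (var l - B l) * H l)"
      using SJ by (intro sum.cong) (auto simp: L_def)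
    also have "(\<Sum>x\<in>S. L x * (if x \<in> J then H x else K x)) = Fs"
      unfolding Fs_L using SJ by (intro sum.cong) auto
    finally show "F = (\<Sum>x\<in>J \<union> S. L x * (if x \<in> J then H x else K x))"
      by (intro trans[OF H(2)]) (simp add: add.commute)
    show "card (J \<union> S) \<le> card J + card A" using card card_Un_le[of J S] by linarith
  qed (use L_form K_form H(1) in auto)
qed

end

lemma has_collapse_mono:
  assumes "has_collapse k F" "k \<le> l"
  shows "has_collapse l F"
proof -
  obtain G H where GH: "F = (\<Sum>i<k. G i * H i)"
    "\<forall>i<k. (G i = 0 \<or> 0 < total_degree (G i) \<and> total_degree (G i) < total_degree F \<and>
        is_form (total_degree (G i)) (G i)) \<and>
      (H i = 0 \<or> is_form (total_degree F - total_degree (G i)) (H i))"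
    using assms(1) unfolding has_collapse_def by blast
  have "(\<Sum>i<k. G i * H i) = (\<Sum>i<l. (if i < k then G i else 0) * (if i < k then H i else 0))"
    using assms(2) by (intro sum.mono_neutral_cong_left) auto
  with GH show ?thesis
    unfolding has_collapse_def
    by (intro exI[of _ "\<lambda>i. if i < k then G i else 0"] exI[of _ "\<lambda>i. if i < k then H i else 0"]) auto
qed

lemma jacobian_subset_prime:
  fixes F :: "('n::finite, 'k::comm_ring_1) mpoly"
  assumes "jacobian_ideal F \<subseteq> P"
  shows "partial_deriv l F \<in> P"
proof -
  interpret ring "ring_of_type_algebra :: ('n, 'k) mpoly ring" by (rule ring_from_type_algebra)
  have "insert F (range (\<lambda>i. partial_deriv i F)) \<subseteq> jacobian_ideal F"
    unfolding jacobian_ideal_def by (rule genideal_self) (simp add: ring_of_type_algebra_def)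
  with assms show ?thesis by blast
qed

text \<open>
  Both \<open>J\<close> (codimension of the tangent space) and \<open>A\<close> (codimension in the sense of transcendence
  degree) have at most \<open>c\<close> elements, where \<open>c\<close> is the height of a prime over the Jacobian ideal.
\<close>

lemma small_height_collapse:
  fixes F :: "('n::finite, 'k::alg_closed_field) mpoly"
  assumes F: "is_form 3 F" and low: "\<not> enat k \<le> ideal_height ring_of_type_algebra (jacobian_ideal F)"
  obtains c where "c < k" "CHAR('k) = 2 \<Longrightarrow> has_collapse (2 * c) F" "CHAR('k) = 3 \<Longrightarrow> has_collapse (c + 1) F"
proof -
  obtain P where P: "is_prime P" "jacobian_ideal F \<subseteq> P" and ht: "prime_height ring_of_type_algebra P < enat k"
    using low unfolding ideal_height_def by (auto simp: le_Inf_iff not_le)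
  have sing: "partial_deriv l F \<in> P" for l by (rule jacobian_subset_prime[OF P(2)])
  obtain c where c: "prime_height ring_of_type_algebra P = enat c" "c < k"
    using ht by (cases "prime_height ring_of_type_algebra P") auto
  obtain J where J: "card J \<le> c" "tangent_frame P J"
    using ex_tangent_frame[OF P(1)] c(1) by (auto intro: order_trans)
  obtain A where A: "card A \<le> c" "\<forall>g\<in>P. (\<forall>l\<in>A. free_of l g) \<longrightarrow> g = 0"
    using prime_contains_no_free[OF P(1)] c(1) by (auto intro: order_trans)
  obtain b where "tangent_section F P J b"
  proof (rule third_polar_vanishes[OF P(1) F sing J(2)])
    fix b :: "'n \<Rightarrow> 'n \<Rightarrow> 'k"
    assume "\<And>j l. j \<notin> J \<Longrightarrow> l \<notin> J \<Longrightarrow> b j l = (if l = j then 1 else 0)"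
      and "\<And>i j k. i \<notin> J \<Longrightarrow> j \<notin> J \<Longrightarrow> k \<notin> J \<Longrightarrow>
        (\<Sum>l\<in>UNIV. \<Sum>a\<in>UNIV. \<Sum>c\<in>UNIV. b k l * (b j a * (b i c *
          Poly_Mapping.lookup (partial_deriv c (partial_deriv a (partial_deriv l F))) 0))) = 0"
    with P(1) F sing have "tangent_section F P J b" by (rule tangent_section.intro)
    then show thesis by (rule that)
  qed
  then interpret tangent_section F P J b .
  show thesis
  proof (rule that[OF c(2)])
    show "has_collapse (2 * c) F" if "CHAR('k) = 2"
      by (rule has_collapse_mono[OF collapse_char_2[OF that A(2)]]) (use J(1) A(1) in simp)
    show "has_collapse (c + 1) F" if "CHAR('k) = 3"
      by (rule has_collapse_mono[OF collapse_char_3[OF that]]) (use J(1) in simp)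
  qed
qed

theorem theorem1p16:
  fixes F :: "('n::finite, 'k::alg_closed_field) mpoly" and k :: nat
  assumes "k \<ge> 1" and "is_form 3 F"
  shows "(CHAR('k) = 2 \<longrightarrow> strong (2 * (k - 1) * (2 * k + 1)) F \<longrightarrow>
            enat k \<le> ideal_height ring_of_type_algebra (jacobian_ideal F)) \<and>
         (CHAR('k) = 3 \<longrightarrow> strong (2 * k ^ 2 - k) F \<longrightarrow>
            enat k \<le> ideal_height ring_of_type_algebra (jacobian_ideal F))"
proof (intro conjI impI)
  assume ch: "CHAR('k) = 2" and strong: "strong (2 * (k - 1) * (2 * k + 1)) F"
  show "enat k \<le> ideal_height ring_of_type_algebra (jacobian_ideal F)"
  proof (rule ccontr)
    assume "\<not> ?thesis"
    then obtain c where c: "c < k" "has_collapse (2 * c) F"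
      by (rule small_height_collapse[OF assms(2)]) (use ch in auto)
    have "2 * c \<le> 2 * (k - 1)" using c(1) by simp
    also have "\<dots> \<le> 2 * (k - 1) * (2 * k + 1)" by simp
    finally show False using has_collapse_mono[OF c(2)] strong by (simp add: strong_def)
  qed
next
  assume ch: "CHAR('k) = 3" and strong: "strong (2 * k ^ 2 - k) F"
  show "enat k \<le> ideal_height ring_of_type_algebra (jacobian_ideal F)"
  proof (rule ccontr)
    assume "\<not> ?thesis"
    then obtain c where c: "c < k" "has_collapse (c + 1) F"
      by (rule small_height_collapse[OF assms(2)]) (use ch in auto)
    have "k \<le> k ^ 2" using assms(1) by (simp add: power2_eq_square)
    then have "c + 1 \<le> 2 * k ^ 2 - k" using c(1) by linarith
    from has_collapse_mono[OF c(2) this] strong show False by (simp add: strong_def)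
  qed
qed

end
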